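(* Let $\varepsilon>0$ be a constant and suppose $n=2^{o(k)}$. Any algorithm that achieves a $(1/2+\varepsilon)$-approximation for maximizing a non-negative (non-monotone) submodular function over an $n$-element ground set subject to the cardinality constraint $k$ in the random-order streaming model must use a buffer of size $\Omega(n/k^2)$. This holds even for stronger algorithms that are allowed (i) to store an unlimited number of bits of information (only the number of stored elements counts toward the memory cost), and (ii) to output, at the end of the stream, an arbitrary subset of the ground set of size at most $k$ (while during the stream they may still only query subsets of currently stored elements).
   Context: A function $f:2^E\to\mathbb{R}_{\ge0}$ is submodular if for all $S\subseteq T\subseteq E$ and $i\in E\setminus T$, $f(S\cup\{i\})-f(S)\ge f(T\cup\{i\})-f(T)$. Random-order streaming model: the elements of the ground set $E$ arrive one by one in a uniformly random order, each seen once. The algorithm maintains a memory buffer whose cost at any time is (number of stored elements) + (number of bits of other stored information). When an element arrives the algorithm may store it and/or discard stored elements and information. At any time it may make any number of value-oracle queries to $f$, but only on subsets of elements currently stored; query results may be retained as information. In the standard model, at the end it outputs a subset of at most $k$ stored elements. An $\alpha$-approximation means the output's expected value is at least $\alpha\max_{|Y|\le k}f(Y)$. *)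

theory Defs
  imports
    "HOL-Probability.Probability"
    "HOL-Combinatorics.Multiset_Permutations"
    "HOL-Library.Landau_Symbols"
begin

section \<open>Non-negative submodular functions\<close>

definition submodular_on :: "'a set \<Rightarrow> ('a set \<Rightarrow> real) \<Rightarrow> bool" where
  "submodular_on E f \<longleftrightarrow>
     (\<forall>S T i. S \<subseteq> T \<longrightarrow> T \<subseteq> E \<longrightarrow> i \<in> E - T \<longrightarrow>
        f (insert i S) - f S \<ge> f (insert i T) - f T)"

definition nonneg_submodular :: "'a set \<Rightarrow> ('a set \<Rightarrow> real) \<Rightarrow> bool" where
  "nonneg_submodular E f \<longleftrightarrow> (\<forall>S\<subseteq>E. 0 \<le> f S) \<and> submodular_on E f"

definition opt_value :: "'a set \<Rightarrow> nat \<Rightarrow> ('a set \<Rightarrow> real) \<Rightarrow> real" where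
  "opt_value E k f = Max (f ` {Y. Y \<subseteq> E \<and> card Y \<le> k})"


section \<open>Streaming algorithms\<close>

text \<open>
  A memory state consists of the set of stored elements and the other stored information.
  Everything that an algorithm does is a function of its current memory state, of the coin
  drawn for the current step and of the stream element or oracle answer it has just received.
  In a step it either queries a set and moves to a new state depending on the answer, or it
  proceeds along the stream. Discarding elements or rewriting the information without need of
  an oracle answer is a query of the empty set whose answer is ignored.
\<close>

type_synonym ('a, 'i) mem = "'a set \<times> 'i"

datatype ('a, 'i) action =
    Query "'a set" "real \<Rightarrow> ('a, 'i) mem"
  | Proceed

text \<open>
  The coin of step \<open>t\<close> is the \<open>t\<close>-th entry of a random sequence with law \<open>coins\<close>. Independent
  fresh coins are the case of a product measure; an arbitrary joint law also admits, for example,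
  a shared random string that can be read again in every step. Randomness is not charged
  to the memory. An argument \<open>None\<close> of \<open>receive\<close> signals the end of the stream, after which the
  algorithm may still query before it produces its output.
\<close>

record ('a, 'i, 'r) stream_algorithm =
  coins :: "(nat \<Rightarrow> 'r) measure"
  initial_info :: 'i
  action_of :: "'r \<Rightarrow> ('a, 'i) mem \<Rightarrow> ('a, 'i) action"
  receive :: "'r \<Rightarrow> 'a option \<Rightarrow> ('a, 'i) mem \<Rightarrow> ('a, 'i) mem"
  output_of :: "'r \<Rightarrow> ('a, 'i) mem \<Rightarrow> 'a set"

datatype ('a, 'i) config =
    Running "'a option list" "('a, 'i) mem"
  | Halted "'a set"

fun step :: "('a, 'i, 'r) stream_algorithm \<Rightarrow> ('a set \<Rightarrow> real) \<Rightarrow> 'r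
    \<Rightarrow> ('a, 'i) config \<Rightarrow> ('a, 'i) config" where
  "step A f r (Halted Y) = Halted Y"
| "step A f r (Running es s) =
     (case action_of A r s of
        Query S next_mem \<Rightarrow> Running es (next_mem (f S))
      | Proceed \<Rightarrow>
          (case es of
             [] \<Rightarrow> Halted (output_of A r s)
           | e # es' \<Rightarrow> Running es' (receive A r e s)))"

primrec run :: "('a, 'i, 'r) stream_algorithm \<Rightarrow> ('a set \<Rightarrow> real) \<Rightarrow> 'a list
    \<Rightarrow> (nat \<Rightarrow> 'r) \<Rightarrow> nat \<Rightarrow> ('a, 'i) config" where
  "run A f \<sigma> \<omega> 0 = Running (map Some \<sigma> @ [None]) ({}, initial_info A)"
| "run A f \<sigma> \<omega> (Suc t) = step A f (\<omega> t) (run A f \<sigma> \<omega> t)"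

definition outcome :: "('a, 'i, 'r) stream_algorithm \<Rightarrow> ('a set \<Rightarrow> real) \<Rightarrow> 'a list
    \<Rightarrow> (nat \<Rightarrow> 'r) \<Rightarrow> 'a set option" where
  "outcome A f \<sigma> \<omega> =
     (if \<exists>t Y. run A f \<sigma> \<omega> t = Halted Y
      then Some (THE Y. \<exists>t. run A f \<sigma> \<omega> t = Halted Y) else None)"

text \<open>
  The arriving element can be queried only after it has been put into the memory, where it counts
  as stored. The last condition says that the outcome is a random variable.
\<close>

definition stream_algorithm_on :: "'a set \<Rightarrow> ('a, 'i, 'r) stream_algorithm \<Rightarrow> bool" where
  "stream_algorithm_on E A \<longleftrightarrow>
     prob_space (coins A) \<and>
     (\<forall>r M w S next_mem. M \<subseteq> E \<longrightarrow> action_of A r (M, w) = Query S next_mem \<longrightarrow>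
        S \<subseteq> M \<and> (\<forall>x. fst (next_mem x) \<subseteq> M)) \<and>
     (\<forall>r M w. M \<subseteq> E \<longrightarrow> fst (receive A r None (M, w)) \<subseteq> M) \<and>
     (\<forall>r M w. \<forall>e\<in>E. M \<subseteq> E \<longrightarrow> fst (receive A r (Some e) (M, w)) \<subseteq> insert e M) \<and>
     (\<forall>f. \<forall>\<sigma>\<in>permutations_of_set E. nonneg_submodular E f \<longrightarrow>
        outcome A f \<sigma> \<in> measurable (coins A) (count_space UNIV))"

text \<open>
  In the standard model the information is a bit string and the output consists of stored elements.
  In the strong model the information is of an arbitrary type and the output is an arbitrary
  subset of the ground set.
\<close>

definition standard_algorithm ::
    "'a set \<Rightarrow> nat \<Rightarrow> ('a, bool list, 'r) stream_algorithm \<Rightarrow> bool" where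
  "standard_algorithm E k A \<longleftrightarrow> stream_algorithm_on E A \<and>
     (\<forall>r M w. M \<subseteq> E \<longrightarrow> output_of A r (M, w) \<subseteq> M \<and> card (output_of A r (M, w)) \<le> k)"

definition strong_algorithm ::
    "'a set \<Rightarrow> nat \<Rightarrow> ('a, 'i, 'r) stream_algorithm \<Rightarrow> bool" where
  "strong_algorithm E k A \<longleftrightarrow> stream_algorithm_on E A \<and>
     (\<forall>r M w. M \<subseteq> E \<longrightarrow> output_of A r (M, w) \<subseteq> E \<and> card (output_of A r (M, w)) \<le> k)"

definition standard_cost :: "('a, bool list) mem \<Rightarrow> nat" where
  "standard_cost s = card (fst s) + length (snd s)"

definition element_cost :: "('a, 'i) mem \<Rightarrow> nat" where
  "element_cost s = card (fst s)"

definition buffer_at_most ::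
    "(('a, 'i) mem \<Rightarrow> nat) \<Rightarrow> 'a set \<Rightarrow> ('a, 'i, 'r) stream_algorithm \<Rightarrow> nat \<Rightarrow> bool" where
  "buffer_at_most cost E A m \<longleftrightarrow>
     (\<forall>f. \<forall>\<sigma>\<in>permutations_of_set E. \<forall>\<omega>\<in>space (coins A). \<forall>t es s.
        nonneg_submodular E f \<longrightarrow> run A f \<sigma> \<omega> t = Running es s \<longrightarrow> cost s \<le> m)"

text \<open>An execution that does not terminate has no output and contributes the value 0.\<close>

definition value_of :: "('a set \<Rightarrow> real) \<Rightarrow> 'a set option \<Rightarrow> real" where
  "value_of f Y = (case Y of None \<Rightarrow> 0 | Some Y \<Rightarrow> f Y)"

definition expected_value ::
    "'a set \<Rightarrow> ('a, 'i, 'r) stream_algorithm \<Rightarrow> ('a set \<Rightarrow> real) \<Rightarrow> real" where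
  "expected_value E A f =
     measure_pmf.expectation (pmf_of_set (permutations_of_set E))
       (\<lambda>\<sigma>. \<integral>\<omega>. value_of f (outcome A f \<sigma> \<omega>) \<partial>coins A)"

definition achieves_approximation ::
    "real \<Rightarrow> 'a set \<Rightarrow> nat \<Rightarrow> ('a, 'i, 'r) stream_algorithm \<Rightarrow> bool" where
  "achieves_approximation \<alpha> E k A \<longleftrightarrow>
     (\<forall>f. nonneg_submodular E f \<longrightarrow> expected_value E A f \<ge> \<alpha> * opt_value E k f)"

end

theory Submission imports Defs begin

text \<open>
  The ground set contains a set \<open>V\<close> of \<open>a * b\<close> elements, a small fraction of \<open>k\<close>, and about \<open>n / k\<close>
  disjoint blocks of about \<open>k\<close> elements. Block \<open>j\<close> is labelled with a set \<open>C j \<subseteq> V\<close> of size \<open>b\<close>, and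
  two labels meet in only about \<open>b / a\<close> elements, as random ones do; so many labels exist because
  \<open>ln n = o(k)\<close>. A set is rewarded for elements \<open>v\<close> of \<open>V\<close> that it leaves out but covers by elements
  of blocks whose label contains \<open>v\<close>, and it gets \<open>1 / a\<close> for every element of \<open>V\<close> that it contains.
  In a decoy block only few elements count, so every set of size \<open>k\<close> must draw on many labels, behaves
  as if its labels were uniform and has value at most about \<open>b\<close>. In the planted block \<open>J\<close> all elements
  count, and \<open>B J \<union> (V - C J)\<close> has value \<open>b (2 - 1 / a)\<close>, almost twice as much.

  The planted block is invisible unless the memory holds more than \<open>2 r\<close> of its elements, where \<open>r\<close> is a
  small fraction of \<open>k\<close>. Cut the stream into about \<open>k\<close> windows. In a random order a block rarely has more
  than \<open>r\<close> elements in one window, and otherwise it has more than \<open>r\<close> elements in memory at the start of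
  some window. Hence a run on the decoy function exposes few of the blocks, and its output depends on
  no other one, so for a uniformly random \<open>J\<close> the algorithm does no better than on the decoy function.
\<close>

section \<open>Nearly independent label sets\<close>

abbreviation words :: "nat \<Rightarrow> nat \<Rightarrow> (nat \<Rightarrow> nat) set" where
  "words a b \<equiv> PiE {..<b} (\<lambda>_. {..<a})"

definition agreement :: "nat \<Rightarrow> (nat \<Rightarrow> nat) \<Rightarrow> (nat \<Rightarrow> nat) \<Rightarrow> nat" where
  "agreement b \<phi> \<psi> = card {x \<in> {..<b}. \<phi> x = \<psi> x}"

text \<open>The power is a product over positions, so the sum over words factorises; at each
  position one letter agrees, with weight \<open>z\<close>, and \<open>a - 1\<close> letters do not.
  Up to the factor \<open>a ^ b\<close> this is the generating function of the agreement of a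
  uniform word with \<open>\<psi>\<close>.\<close>

lemma sum_power_agreement:
  fixes z :: real
  assumes "\<psi> \<in> words a b"
  shows "(\<Sum>\<phi>\<in>words a b. z ^ agreement b \<phi> \<psi>) = (real a + z - 1) ^ b"
proof -
  have "z ^ agreement b \<phi> \<psi> = (\<Prod>x<b. if \<phi> x = \<psi> x then z else 1)" for \<phi>
    unfolding agreement_def by (simp add: prod.If_cases Int_def)
  then have "(\<Sum>\<phi>\<in>words a b. z ^ agreement b \<phi> \<psi>)
      = (\<Prod>x<b. \<Sum>y<a. if y = \<psi> x then z else 1)"
    by (subst prod_sum_PiE) auto
  also have "\<dots> = (\<Prod>x<b. real a + z - 1)"
  proof (intro prod.cong refl)
    fix x assume "x \<in> {..<b}"
    then have x: "\<psi> x < a" using assms by auto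
    have "(\<Sum>y<a. if y = \<psi> x then z else 1) = (\<Sum>y<a. 1 + (if y = \<psi> x then z - 1 else 0))"
      by (intro sum.cong) auto
    then show "(\<Sum>y<a. if y = \<psi> x then z else 1) = real a + z - 1"
      using x by (simp add: sum.distrib)
  qed
  finally show ?thesis by simp
qed

text \<open>Exponential Markov inequality with base \<open>1 + \<eta>\<close>.\<close>
lemma card_large_agreement:
  fixes \<eta> :: real
  assumes \<psi>: "\<psi> \<in> words a b" and a: "2 \<le> a" and \<eta>: "0 < \<eta>" "\<eta> \<le> 1 / 4"
  shows "real (card {\<phi> \<in> words a b. b / a + \<eta> * b < agreement b \<phi> \<psi>}) \<le> a ^ b * exp (- (\<eta>\<^sup>2 * b / 4))"
proof -
  let ?bad = "{\<phi> \<in> words a b. b / a + \<eta> * b < agreement b \<phi> \<psi>}"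
  let ?h = "b / a + \<eta> * b"
  have fin: "finite (words a b)" by (intro finite_PiE) auto
  have ln: "\<eta> - \<eta>\<^sup>2 \<le> ln (1 + \<eta>)" using \<eta> by (intro ln_one_plus_pos_lower_bound) auto
  have ln0: "0 \<le> ln (1 + \<eta>)" using \<eta> by simp
  have "card ?bad * exp ((\<eta> - \<eta>\<^sup>2) * ?h) = (\<Sum>\<phi>\<in>?bad. exp ((\<eta> - \<eta>\<^sup>2) * ?h))" by simp
  also have "\<dots> \<le> (\<Sum>\<phi>\<in>?bad. (1 + \<eta>) ^ agreement b \<phi> \<psi>)"
  proof (intro sum_mono)
    fix \<phi> assume "\<phi> \<in> ?bad"
    then have less: "?h \<le> agreement b \<phi> \<psi>" by simp
    have "(\<eta> - \<eta>\<^sup>2) * ?h \<le> ln (1 + \<eta>) * ?h" using ln \<eta> by (intro mult_right_mono) auto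
    also have "\<dots> \<le> ln (1 + \<eta>) * agreement b \<phi> \<psi>" using less ln0 by (intro mult_left_mono)
    finally have "exp ((\<eta> - \<eta>\<^sup>2) * ?h) \<le> exp (agreement b \<phi> \<psi> * ln (1 + \<eta>))"
      by (simp add: mult.commute)
    also have "\<dots> = (1 + \<eta>) ^ agreement b \<phi> \<psi>"
      using \<eta> by (simp add: exp_of_nat_mult)
    finally show "exp ((\<eta> - \<eta>\<^sup>2) * ?h) \<le> (1 + \<eta>) ^ agreement b \<phi> \<psi>" .
  qed
  also have "\<dots> \<le> (\<Sum>\<phi>\<in>words a b. (1 + \<eta>) ^ agreement b \<phi> \<psi>)"
    using fin \<eta> by (intro sum_mono2) auto
  also have "\<dots> = (a + \<eta>) ^ b" using sum_power_agreement[OF \<psi>, of "1 + \<eta>"] by simp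
  also have "\<dots> = a ^ b * (1 + \<eta> / a) ^ b"
    using a by (simp add: power_mult_distrib[symmetric] field_simps)
  also have "\<dots> \<le> a ^ b * exp (\<eta> / a) ^ b"
    using a \<eta> by (intro mult_left_mono power_mono) (auto simp: add_nonneg_nonneg)
  also have "\<dots> = a ^ b * exp (b * (\<eta> / a))" by (simp only: exp_of_nat_mult)
  finally have "card ?bad * exp ((\<eta> - \<eta>\<^sup>2) * ?h) * exp (- ((\<eta> - \<eta>\<^sup>2) * ?h))
      \<le> a ^ b * exp (b * (\<eta> / a)) * exp (- ((\<eta> - \<eta>\<^sup>2) * ?h))"
    by (rule mult_right_mono) simp
  then have "card ?bad \<le> a ^ b * exp (b * (\<eta> / a) - (\<eta> - \<eta>\<^sup>2) * ?h)"
    by (simp add: mult.assoc flip: exp_add)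
  also have "\<dots> \<le> a ^ b * exp (- (\<eta>\<^sup>2 * b / 4))"
  proof (intro mult_left_mono)
    \<comment> \<open>The terms of order \<open>\<eta>\<close> cancel in the exponent, leaving
      \<open>b * \<eta>^2 * (1 / a + \<eta> - 1)\<close>; with \<open>a \<ge> 2\<close> and
      \<open>\<eta> \<le> 1 / 4\<close> the bracket is at most \<open>- 1 / 4\<close>, the source of
      the constant 4.\<close>
    have "1 / real a \<le> 1 / 2" using a by simp
    then have "1 / real a + \<eta> \<le> 3 / 4" using \<eta> by linarith
    then have "\<eta>\<^sup>2 * (1 / a + \<eta>) \<le> \<eta>\<^sup>2 * (3 / 4)" by (rule mult_left_mono) simp
    then have "b * (\<eta>\<^sup>2 * (1 / a + \<eta>)) \<le> b * (\<eta>\<^sup>2 * (3 / 4))" by (rule mult_left_mono) simp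
    also have "\<dots> = b * \<eta>\<^sup>2 - \<eta>\<^sup>2 * b / 4" by simp
    finally have "b * (\<eta>\<^sup>2 * (1 / a + \<eta>)) - b * \<eta>\<^sup>2 \<le> - (\<eta>\<^sup>2 * b / 4)"
      unfolding mult.commute[of "\<eta>\<^sup>2" "real b"] by linarith
    moreover have "b * (\<eta> / a) - (\<eta> - \<eta>\<^sup>2) * ?h = b * (\<eta>\<^sup>2 * (1 / a + \<eta>)) - b * \<eta>\<^sup>2"
      by (simp add: algebra_simps power2_eq_square add_divide_distrib diff_divide_distrib)
    ultimately show "exp (b * (\<eta> / a) - (\<eta> - \<eta>\<^sup>2) * ?h) \<le> exp (- (\<eta>\<^sup>2 * b / 4))"
      unfolding exp_le_cancel_iff by linarith
  qed simp
  finally show ?thesis by simp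
qed

text \<open>Greedy choice as in the Gilbert-Varshamov bound: by \<open>card_large_agreement\<close>
  each word chosen so far rules out at most a fraction \<open>exp (- (\<eta>^2 * b / 4))\<close> of
  all words, so fewer than \<open>exp (\<eta>^2 * b / 4)\<close> of them leave a candidate.\<close>

lemma words_with_small_agreement:
  fixes \<eta> :: real
  assumes a: "2 \<le> a" and \<eta>: "0 < \<eta>" "\<eta> \<le> 1 / 4" and "real L \<le> exp (\<eta>\<^sup>2 * b / 4)"
  shows "\<exists>\<psi>. (\<forall>j<L. \<psi> j \<in> words a b) \<and>
    (\<forall>i<L. \<forall>j<L. i \<noteq> j \<longrightarrow> agreement b (\<psi> i) (\<psi> j) \<le> b / a + \<eta> * b)"
  using assms(4)
proof (induction L)
  case 0
  then show ?case by simp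
next
  case (Suc L)
  then have "\<exists>\<psi>. (\<forall>j<L. \<psi> j \<in> words a b) \<and>
    (\<forall>i<L. \<forall>j<L. i \<noteq> j \<longrightarrow> agreement b (\<psi> i) (\<psi> j) \<le> b / a + \<eta> * b)"
    by simp
  then obtain \<psi> where "\<forall>j<L. \<psi> j \<in> words a b"
    "\<forall>i<L. \<forall>j<L. i \<noteq> j \<longrightarrow> agreement b (\<psi> i) (\<psi> j) \<le> b / a + \<eta> * b"
    by (elim exE conjE)
  then have \<psi>: "\<And>j. j < L \<Longrightarrow> \<psi> j \<in> words a b"
    "\<And>i j. i < L \<Longrightarrow> j < L \<Longrightarrow> i \<noteq> j \<Longrightarrow> agreement b (\<psi> i) (\<psi> j) \<le> b / a + \<eta> * b"
    by simp_all
  let ?bad = "\<lambda>j. {\<phi> \<in> words a b. b / a + \<eta> * b < agreement b \<phi> (\<psi> j)}"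
  have fin: "finite (words a b)" by (intro finite_PiE) auto
  have "real (card (\<Union>j<L. ?bad j)) \<le> real (\<Sum>j<L. card (?bad j))"
    by (intro of_nat_mono card_UN_le) simp
  also have "\<dots> = (\<Sum>j<L. real (card (?bad j)))" by (rule of_nat_sum)
  also have "\<dots> \<le> (\<Sum>j<L. a ^ b * exp (- (\<eta>\<^sup>2 * b / 4)))"
    using card_large_agreement[OF \<psi>(1) a \<eta>] by (intro sum_mono) auto
  also have "\<dots> = real L * exp (- (\<eta>\<^sup>2 * b / 4)) * a ^ b" by simp
  also have "\<dots> < 1 * real (a ^ b)"
  proof (rule mult_strict_right_mono)
    have "real L < exp (\<eta>\<^sup>2 * b / 4)" using Suc.prems by simp
    then have "real L * exp (- (\<eta>\<^sup>2 * b / 4)) < exp (\<eta>\<^sup>2 * b / 4) * exp (- (\<eta>\<^sup>2 * b / 4))"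
      by (intro mult_strict_right_mono) auto
    then show "real L * exp (- (\<eta>\<^sup>2 * b / 4)) < 1" by (simp flip: exp_add)
  qed (use a in simp)
  also have "1 * real (a ^ b) = card (words a b)" by (simp add: card_PiE)
  finally have "card (\<Union>j<L. ?bad j) < card (words a b)" by simp
  then have "\<not> words a b \<subseteq> (\<Union>j<L. ?bad j)"
    using card_mono[of "\<Union>j<L. ?bad j" "words a b"] fin by auto
  then obtain \<phi> where \<phi>: "\<phi> \<in> words a b" "\<phi> \<notin> (\<Union>j<L. ?bad j)" by blast
  have sym: "agreement b \<alpha> \<beta> = agreement b \<beta> \<alpha>" for \<alpha> \<beta>
    unfolding agreement_def by (simp add: eq_commute)
  have small: "agreement b \<phi> (\<psi> j) \<le> b / a + \<eta> * b" if "j < L" for j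
    using \<phi> that by (auto simp: not_less)
  show ?case
  proof (intro exI[of _ "\<psi>(L := \<phi>)"] conjI allI impI)
    fix j assume "j < Suc L"
    then show "(\<psi>(L := \<phi>)) j \<in> words a b" using \<psi>(1) \<phi>(1) by (cases "j = L") auto
  next
    fix i j assume "i < Suc L" "j < Suc L" "i \<noteq> j"
    then show "agreement b ((\<psi>(L := \<phi>)) i) ((\<psi>(L := \<phi>)) j) \<le> b / a + \<eta> * b"
      using \<psi>(2)[of i j] small[of i] small[of j] sym[of \<phi>] by (auto simp: less_Suc_eq)
  qed
qed

text \<open>\<open>V\<close> is read as the grid of positions times letters, and the label of a word
  is its graph. It has one point per position, hence size \<open>b\<close>, and two graphs meet
  exactly where the words agree.\<close>

lemma nearly_independent_sets:
  fixes V :: "'a set" and \<eta> :: real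
  assumes V: "finite V" "card V = a * b" and a: "2 \<le> a" and \<eta>: "0 < \<eta>" "\<eta> \<le> 1 / 4"
    and L: "real L \<le> exp (\<eta>\<^sup>2 * b / 4)"
  obtains C where "\<And>j. j < L \<Longrightarrow> C j \<subseteq> V" "\<And>j. j < L \<Longrightarrow> card (C j) = b"
    "\<And>i j. i < L \<Longrightarrow> j < L \<Longrightarrow> i \<noteq> j \<Longrightarrow> card (C i \<inter> C j) \<le> b / a + \<eta> * b"
proof -
  obtain \<psi> where "\<forall>j<L. \<psi> j \<in> words a b"
    "\<forall>i<L. \<forall>j<L. i \<noteq> j \<longrightarrow> agreement b (\<psi> i) (\<psi> j) \<le> b / a + \<eta> * b"
    using words_with_small_agreement[OF a \<eta> L] by (elim exE conjE)
  then have \<psi>: "\<And>j. j < L \<Longrightarrow> \<psi> j \<in> words a b"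
    "\<And>i j. i < L \<Longrightarrow> j < L \<Longrightarrow> i \<noteq> j \<Longrightarrow> agreement b (\<psi> i) (\<psi> j) \<le> b / a + \<eta> * b"
    by simp_all
  have "card ({..<b} \<times> {..<a}) = card V" using V by (simp add: card_cartesian_product)
  then obtain \<beta> where \<beta>: "bij_betw \<beta> ({..<b} \<times> {..<a}) V"
    using finite_same_card_bij[of "{..<b} \<times> {..<a}" V] V by auto
  define graph where "graph j = (\<lambda>x. (x, \<psi> j x)) ` {..<b}" for j
  have graph: "graph j \<subseteq> {..<b} \<times> {..<a}" if "j < L" for j
    unfolding graph_def using \<psi>(1)[OF that] by auto
  have inj: "inj_on \<beta> X" if "X \<subseteq> {..<b} \<times> {..<a}" for X
    using \<beta> that by (meson bij_betw_imp_inj_on inj_on_subset)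
  show ?thesis
  proof
    fix j assume j: "j < L"
    show "\<beta> ` graph j \<subseteq> V" using graph[OF j] \<beta> by (auto simp: bij_betw_def)
    have "card (graph j) = b" unfolding graph_def by (subst card_image) (auto simp: inj_on_def)
    then show "card (\<beta> ` graph j) = b" using inj[OF graph[OF j]] by (simp add: card_image)
  next
    fix i j assume ij: "i < L" "j < L" "i \<noteq> j"
    have "\<beta> ` graph i \<inter> \<beta> ` graph j = \<beta> ` (graph i \<inter> graph j)"
      using inj[of "{..<b} \<times> {..<a}"] graph[OF ij(1)] graph[OF ij(2)]
      by (intro inj_on_image_Int[symmetric]) auto
    also have "graph i \<inter> graph j = (\<lambda>x. (x, \<psi> i x)) ` {x \<in> {..<b}. \<psi> i x = \<psi> j x}"
      unfolding graph_def by auto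
    finally have "card (\<beta> ` graph i \<inter> \<beta> ` graph j) \<le> agreement b (\<psi> i) (\<psi> j)"
      unfolding agreement_def image_image by (simp add: card_image_le)
    then show "card (\<beta> ` graph i \<inter> \<beta> ` graph j) \<le> b / a + \<eta> * b"
      using \<psi>(2)[OF ij] by linarith
  qed
qed

section \<open>Cutting the ground set into \<open>V\<close> and disjoint blocks\<close>

lemma obtain_blocks:
  assumes "finite E" "K + L * q \<le> card E"
  obtains V B where "V \<subseteq> E" "card V = K" "\<And>j. j < L \<Longrightarrow> B j \<subseteq> E - V"
    "\<And>j. j < L \<Longrightarrow> card (B j) = q" "disjoint_family_on B {..<L}"
proof -
  obtain \<beta> where \<beta>: "bij_betw \<beta> {..<card E} E"
    using ex_bij_betw_nat_finite[OF assms(1)] by (auto simp: atLeast0LessThan)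
  have inj: "inj_on \<beta> X" if "X \<subseteq> {..<card E}" for X
    using \<beta> that by (meson bij_betw_imp_inj_on inj_on_subset)
  define I where "I j = {K + j * q..<K + Suc j * q}" for j
  have I: "I j \<subseteq> {..<card E}" if "j < L" for j
  proof -
    have "Suc j * q \<le> L * q" using that by (intro mult_right_mono) auto
    then show ?thesis unfolding I_def using assms(2) by auto
  qed
  have K: "{..<K} \<subseteq> {..<card E}" using assms(2) by auto
  have disj: "I i \<inter> I j = {}" if "i < j" for i j
  proof -
    have "Suc i * q \<le> j * q" using that by (intro mult_right_mono) auto
    then show ?thesis unfolding I_def by auto
  qed
  have disj_image: "\<beta> ` X \<inter> \<beta> ` Y = {}" if "X \<inter> Y = {}" "X \<subseteq> {..<card E}" "Y \<subseteq> {..<card E}" for X Y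
    using inj_on_image_Int[OF inj[OF order_refl] that(2,3)] that(1) by simp
  show ?thesis
  proof
    show "\<beta> ` {..<K} \<subseteq> E" using K \<beta> by (auto simp: bij_betw_def)
    show "card (\<beta> ` {..<K}) = K" using inj[OF K] by (simp add: card_image)
    show "card (\<beta> ` I j) = q" if "j < L" for j
      using inj[OF I[OF that]] by (simp add: card_image I_def)
    show "\<beta> ` I j \<subseteq> E - \<beta> ` {..<K}" if "j < L" for j
    proof -
      have "I j \<inter> {..<K} = {}" unfolding I_def by auto
      then have "\<beta> ` I j \<inter> \<beta> ` {..<K} = {}" using I[OF that] K by (rule disj_image)
      moreover have "\<beta> ` I j \<subseteq> E" using I[OF that] \<beta> by (auto simp: bij_betw_def)
      ultimately show ?thesis by auto
    qed
    show "disjoint_family_on (\<lambda>j. \<beta> ` I j) {..<L}"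
      unfolding disjoint_family_on_def
    proof (intro ballI impI)
      fix i j assume ij: "i \<in> {..<L}" "j \<in> {..<L}" "i \<noteq> j"
      have "I i \<inter> I j = {}" using disj[of i j] disj[of j i] ij by (cases "i < j") auto
      then show "\<beta> ` I i \<inter> \<beta> ` I j = {}" using I ij by (intro disj_image) auto
    qed
  qed
qed

section \<open>The hard functions\<close>

text \<open>Truncation at 1 is nondecreasing and concave; this carries diminishing returns over from
  \<open>cover\<close> to the truncated terms of \<open>F\<close>.\<close>

lemma min_one_diff_le:
  fixes x x' d d' :: real
  assumes "x \<le> x'" "0 \<le> d'" "d' \<le> d"
  shows "min 1 (x' + d') - min 1 x' \<le> min 1 (x + d) - min 1 x"
  using assms by (auto simp: min_def)

locale block_instance =
  fixes E V :: "'a set" and B C :: "nat \<Rightarrow> 'a set" and L q a b :: nat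
  assumes finite_E: "finite E"
    and V_subset: "V \<subseteq> E"
    and card_V: "card V = a * b"
    and B_subset: "\<And>j. j < L \<Longrightarrow> B j \<subseteq> E - V"
    and card_B: "\<And>j. j < L \<Longrightarrow> card (B j) = q"
    and disjoint_B: "disjoint_family_on B {..<L}"
    and C_subset: "\<And>j. j < L \<Longrightarrow> C j \<subseteq> V"
    and card_C: "\<And>j. j < L \<Longrightarrow> card (C j) = b"
    and a_pos: "0 < a"
    and q_pos: "0 < q"
begin

text \<open>
  Block \<open>j\<close> contributes at most \<open>\<tau> j\<close> of its elements to the cover of \<open>C j\<close>. The decoy function
  has a small constant cap; the function with planted block \<open>J\<close> has its cap at \<open>J\<close> raised to \<open>q\<close>.
\<close>

definition cover :: "(nat \<Rightarrow> nat) \<Rightarrow> 'a set \<Rightarrow> 'a \<Rightarrow> real" where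
  "cover \<tau> S v = (\<Sum>j<L. if v \<in> C j then real (min (\<tau> j) (card (S \<inter> B j))) else 0)"

text \<open>The weight \<open>1 / a\<close> is the density of a label in \<open>V\<close>, and thus
  the coverage per point when elements of total weight \<open>q\<close> draw on evenly spread
  labels. On such a cover, taking a point of \<open>V\<close> or leaving it out is equally
  good.\<close>

definition F :: "(nat \<Rightarrow> nat) \<Rightarrow> 'a set \<Rightarrow> real" where
  "F \<tau> S = (\<Sum>v\<in>V - S. min 1 (cover \<tau> S v / q)) + real (card (S \<inter> V)) / a"

section \<open>Non-negativity and submodularity of \<open>F\<close>\<close>

lemma finite_V: "finite V"
  using V_subset finite_E finite_subset by blast

lemma finite_B: "j < L \<Longrightarrow> finite (B j)"
  using B_subset finite_E by (meson finite_Diff finite_subset)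

lemma cover_nonneg: "0 \<le> cover \<tau> S v"
  unfolding cover_def by (intro sum_nonneg) auto

lemma F_nonneg: "0 \<le> F \<tau> S"
  unfolding F_def by (intro add_nonneg_nonneg sum_nonneg) (auto simp: cover_nonneg)

lemma cover_mono:
  assumes "S \<subseteq> T"
  shows "cover \<tau> S v \<le> cover \<tau> T v"
  unfolding cover_def
proof (intro sum_mono)
  fix j assume "j \<in> {..<L}"
  then have "card (S \<inter> B j) \<le> card (T \<inter> B j)"
    using assms finite_B by (intro card_mono) auto
  then show "(if v \<in> C j then real (min (\<tau> j) (card (S \<inter> B j))) else 0)
      \<le> (if v \<in> C j then real (min (\<tau> j) (card (T \<inter> B j))) else 0)"
    by auto
qed

lemma cover_insert_outside:
  assumes "\<And>j. j < L \<Longrightarrow> i \<notin> B j"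
  shows "cover \<tau> (insert i S) v = cover \<tau> S v"
  unfolding cover_def using assms by (intro sum.cong) auto

text \<open>Within a block the contribution is a concave function, \<open>min\<close> with the cap,
  of the number of elements present, and a sum of such terms has diminishing returns.\<close>

lemma cover_submodular:
  assumes "S \<subseteq> T" "i \<notin> T"
  shows "cover \<tau> (insert i T) v - cover \<tau> T v \<le> cover \<tau> (insert i S) v - cover \<tau> S v"
  unfolding cover_def sum_subtractf[symmetric]
proof (intro sum_mono)
  fix j assume j: "j \<in> {..<L}"
  then have le: "card (S \<inter> B j) \<le> card (T \<inter> B j)"
    using assms finite_B by (intro card_mono) auto
  have T: "card (insert i T \<inter> B j) = card (T \<inter> B j) + (if i \<in> B j then 1 else 0)"
    using assms finite_B j by (auto simp: Int_insert_left)
  have S: "card (insert i S \<inter> B j) = card (S \<inter> B j) + (if i \<in> B j then 1 else 0)"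
  proof -
    have "i \<notin> S" using assms by auto
    then show ?thesis using finite_B j by (auto simp: Int_insert_left)
  qed
  show "(if v \<in> C j then real (min (\<tau> j) (card (insert i T \<inter> B j))) else 0)
      - (if v \<in> C j then real (min (\<tau> j) (card (T \<inter> B j))) else 0)
    \<le> (if v \<in> C j then real (min (\<tau> j) (card (insert i S \<inter> B j))) else 0)
      - (if v \<in> C j then real (min (\<tau> j) (card (S \<inter> B j))) else 0)"
    unfolding S T using le by (auto simp: min_def)
qed

text \<open>An element of \<open>V\<close> gains \<open>1 / a\<close> and forfeits its own coverage,
  which only grows with the set. An element outside \<open>V\<close> gains the increments of the
  truncated covers over the points left out, and a larger set has fewer such points and smaller
  increments.\<close>

lemma F_submodular: "submodular_on E (F \<tau>)"
  unfolding submodular_on_def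
proof (intro allI impI)
  fix S T i
  assume ST: "S \<subseteq> T" and TE: "T \<subseteq> E" and i: "i \<in> E - T"
  have iS: "i \<notin> S" and iT: "i \<notin> T" using i ST by auto
  have finT: "finite T" using TE finite_E by (rule finite_subset)
  have finS: "finite S" using ST finT by (rule finite_subset)
  show "F \<tau> (insert i T) - F \<tau> T \<le> F \<tau> (insert i S) - F \<tau> S"
  proof (cases "i \<in> V")
    case True
    have marginal: "F \<tau> (insert i U) - F \<tau> U = 1 / a - min 1 (cover \<tau> U i / q)"
      if "i \<notin> U" "finite U" for U
    proof -
      have "\<And>j. j < L \<Longrightarrow> i \<notin> B j" using B_subset True by blast
      then have cov: "cover \<tau> (insert i U) v = cover \<tau> U v" for v
        by (rule cover_insert_outside)
      have V: "V - U = insert i (V - insert i U)" using that True by auto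
      have "(\<Sum>v\<in>V - U. min 1 (cover \<tau> U v / q)) =
          min 1 (cover \<tau> U i / q) + (\<Sum>v\<in>V - insert i U. min 1 (cover \<tau> U v / q))"
        unfolding V using finite_V by (subst sum.insert) auto
      moreover have "card (insert i U \<inter> V) = Suc (card (U \<inter> V))"
        using True that finite_V by (auto simp: Int_insert_left)
      ultimately show ?thesis unfolding F_def cov by (simp add: add_divide_distrib)
    qed
    have "cover \<tau> S i / q \<le> cover \<tau> T i / q"
      using cover_mono[OF ST] q_pos by (simp add: divide_right_mono)
    then show ?thesis using marginal[OF iS finS] marginal[OF iT finT] by auto
  next
    case False
    have marginal: "F \<tau> (insert i U) - F \<tau> U =
        (\<Sum>v\<in>V - U. min 1 (cover \<tau> (insert i U) v / q) - min 1 (cover \<tau> U v / q))" for U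
    proof -
      have "V - insert i U = V - U" "insert i U \<inter> V = U \<inter> V" using False by auto
      then show ?thesis unfolding F_def by (simp add: sum_subtractf)
    qed
    have "F \<tau> (insert i T) - F \<tau> T
        \<le> (\<Sum>v\<in>V - T. min 1 (cover \<tau> (insert i S) v / q) - min 1 (cover \<tau> S v / q))"
      unfolding marginal
    proof (intro sum_mono)
      fix v
      have eq: "cover \<tau> (insert i U) v / q =
          cover \<tau> U v / q + (cover \<tau> (insert i U) v - cover \<tau> U v) / q" for U
        by (simp add: diff_divide_distrib)
      show "min 1 (cover \<tau> (insert i T) v / q) - min 1 (cover \<tau> T v / q)
          \<le> min 1 (cover \<tau> (insert i S) v / q) - min 1 (cover \<tau> S v / q)"
        unfolding eq[of S] eq[of T]
        using cover_mono[OF ST] cover_mono[of T "insert i T"] cover_submodular[OF ST iT] q_pos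
        by (intro min_one_diff_le divide_right_mono divide_nonneg_nonneg) auto
    qed
    \<comment> \<open>The points of \<open>V\<close> in \<open>T - S\<close> may be added because a
      cover never decreases.\<close>
    also have "\<dots> \<le> (\<Sum>v\<in>V - S. min 1 (cover \<tau> (insert i S) v / q) - min 1 (cover \<tau> S v / q))"
    proof (rule sum_mono2)
      fix v
      have "cover \<tau> S v / q \<le> cover \<tau> (insert i S) v / q"
        using cover_mono[of S "insert i S"] q_pos by (intro divide_right_mono) auto
      then show "0 \<le> min 1 (cover \<tau> (insert i S) v / q) - min 1 (cover \<tau> S v / q)" by auto
    qed (use finite_V ST in auto)
    finally show ?thesis unfolding marginal .
  qed
qed

lemma F_nonneg_submodular: "nonneg_submodular E (F \<tau>)"
  unfolding nonneg_submodular_def using F_nonneg F_submodular by blast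

text \<open>Neither cap binds: the old one by hypothesis, the new one because a block has only
  \<open>q\<close> elements. Queries of such sets reveal nothing about the planted block.\<close>

lemma F_raise_cap_eq:
  assumes "card (S \<inter> B J) \<le> \<tau> J" "J < L"
  shows "F (\<tau>(J := q)) S = F \<tau> S"
proof -
  have "card (S \<inter> B J) \<le> q"
    using card_mono[OF finite_B[OF assms(2)], of "S \<inter> B J"] card_B[OF assms(2)] by auto
  then have "cover (\<tau>(J := q)) S v = cover \<tau> S v" for v
    unfolding cover_def using assms by (intro sum.cong) auto
  then show ?thesis unfolding F_def by simp
qed

text \<open>Only the \<open>b\<close> points of \<open>C J\<close> are affected; each cover there
  grows by at most the number of elements of \<open>B J\<close> in \<open>S\<close>, and truncation
  does not enlarge an increase.\<close>

lemma F_raise_cap_le: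
  assumes "J < L"
  shows "F (\<tau>(J := q)) S \<le> F \<tau> S + real b * card (S \<inter> B J) / q"
proof -
  let ?d = "real (card (S \<inter> B J)) / q"
  have cov: "cover (\<tau>(J := q)) S v \<le> cover \<tau> S v + (if v \<in> C J then card (S \<inter> B J) else 0)" for v
  proof -
    have "cover (\<tau>(J := q)) S v \<le> (\<Sum>j<L. (if v \<in> C j then real (min (\<tau> j) (card (S \<inter> B j))) else 0)
        + (if j = J then (if v \<in> C J then real (card (S \<inter> B J)) else 0) else 0))"
      unfolding cover_def by (intro sum_mono) auto
    also have "\<dots> = cover \<tau> S v + (if v \<in> C J then card (S \<inter> B J) else 0)"
      unfolding cover_def sum.distrib using assms by simp
    finally show ?thesis .
  qed
  have "(\<Sum>v\<in>V - S. min 1 (cover (\<tau>(J := q)) S v / q))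
      \<le> (\<Sum>v\<in>V - S. min 1 (cover \<tau> S v / q) + (if v \<in> C J then ?d else 0))"
  proof (intro sum_mono)
    fix v
    have "cover (\<tau>(J := q)) S v / q \<le> cover \<tau> S v / q + (if v \<in> C J then ?d else 0)"
      using divide_right_mono[OF cov[of v], of "real q"] by (auto simp: add_divide_distrib)
    moreover have "0 \<le> (if v \<in> C J then ?d else 0)" by auto
    ultimately show "min 1 (cover (\<tau>(J := q)) S v / q)
        \<le> min 1 (cover \<tau> S v / q) + (if v \<in> C J then ?d else 0)" by linarith
  qed
  also have "\<dots> = (\<Sum>v\<in>V - S. min 1 (cover \<tau> S v / q)) + (\<Sum>v\<in>V - S. if v \<in> C J then ?d else 0)"
    by (simp add: sum.distrib)
  finally have le: "(\<Sum>v\<in>V - S. min 1 (cover (\<tau>(J := q)) S v / q))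
      \<le> (\<Sum>v\<in>V - S. min 1 (cover \<tau> S v / q)) + (\<Sum>v\<in>V - S. if v \<in> C J then ?d else 0)" .
  have "(\<Sum>v\<in>V - S. if v \<in> C J then ?d else 0) \<le> (\<Sum>v\<in>V. if v \<in> C J then ?d else 0)"
    using finite_V by (intro sum_mono2) auto
  also have "\<dots> = (\<Sum>v\<in>V \<inter> C J. ?d)"
    using finite_V by (simp only: sum.inter_restrict)
  also have "V \<inter> C J = C J" using C_subset assms by auto
  also have "(\<Sum>v\<in>C J. ?d) = real b * card (S \<inter> B J) / q" using card_C assms by simp
  finally show ?thesis using le unfolding F_def by linarith
qed

text \<open>Exactly the \<open>b\<close> points of \<open>C J\<close> are left out, and the
  \<open>q\<close> elements of \<open>B J\<close> cover each of them fully; the remaining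
  \<open>a * b - b\<close> points of \<open>V\<close> yield \<open>1 / a\<close> each.\<close>

lemma F_planted:
  assumes "J < L" "\<tau> J = q"
  shows "real b * (2 - 1 / a) \<le> F \<tau> (B J \<union> (V - C J))"
proof -
  let ?S = "B J \<union> (V - C J)"
  have BV: "B J \<inter> V = {}" using B_subset assms by blast
  have VS: "V - ?S = C J" using C_subset[OF assms(1)] BV by auto
  have "min 1 (cover \<tau> ?S v / q) = 1" if "v \<in> C J" for v
  proof -
    have "V \<inter> B J = {}" using BV by auto
    then have "?S \<inter> B J = B J" by auto
    then have "real q = (\<Sum>j\<in>{J}. if v \<in> C j then real (min (\<tau> j) (card (?S \<inter> B j))) else 0)"
      using that assms card_B by simp
    also have "\<dots> \<le> cover \<tau> ?S v"
      unfolding cover_def using assms by (intro sum_mono2) auto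
    finally show ?thesis using q_pos by (auto simp: min_def)
  qed
  then have "(\<Sum>v\<in>V - ?S. min 1 (cover \<tau> ?S v / q)) = b"
    unfolding VS using card_C assms by simp
  moreover have "real (card (?S \<inter> V)) = a * b - b"
  proof -
    have "?S \<inter> V = V - C J" using BV by auto
    moreover have "card (V - C J) = a * b - b"
      using C_subset[OF assms(1)] card_C[OF assms(1)] card_V finite_V
      by (subst card_Diff_subset) (auto intro: finite_subset)
    ultimately show ?thesis using a_pos by (simp add: of_nat_diff)
  qed
  ultimately have "F \<tau> ?S = b + (a * b - b) / a" unfolding F_def by simp
  also have "\<dots> = real b * (2 - 1 / a)" using a_pos by (simp add: field_simps)
  finally show ?thesis by simp
qed

text \<open>
  Near-orthogonality of the \<open>C j\<close> bounds the variance of the cover over \<open>V\<close>, so under a small cap a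
  set of \<open>k\<close> elements covers every subset of \<open>V\<close> about as badly as \<open>V\<close> as a whole.
\<close>
lemma F_small:
  fixes h \<nu> :: real and k t :: nat
  assumes overlap: "\<And>i j. i < L \<Longrightarrow> j < L \<Longrightarrow> i \<noteq> j \<Longrightarrow> card (C i \<inter> C j) \<le> b / a + h * b"
    and k: "q \<le> k" and \<nu>: "0 \<le> \<nu>" "real a * (real t * real k + h * (real k)\<^sup>2) \<le> (\<nu> * real k)\<^sup>2" and h: "0 \<le> h"
    and Y: "Y \<subseteq> E" "card Y \<le> k"
  shows "F (\<lambda>_. t) Y \<le> real k / q * b * (1 + \<nu>)"
proof -
  define w where "w j = real (min t (card (Y \<inter> B j)))" for j
  define W where "W = (\<Sum>j<L. w j)"
  define y where "y v = cover (\<lambda>_. t) Y v" for v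
  have y: "y v = (\<Sum>j<L. w j * indicator (C j) v)" for v
    unfolding y_def cover_def w_def by (intro sum.cong) (auto simp: indicator_def)
  have w0: "0 \<le> w j" and wt: "w j \<le> t" for j unfolding w_def by auto
  have finY: "finite Y" using Y(1) finite_E by (rule finite_subset)
  have "W \<le> (\<Sum>j<L. real (card (Y \<inter> B j)))"
    unfolding W_def w_def by (intro sum_mono) auto
  also have "\<dots> = card (\<Union>j<L. Y \<inter> B j)"
  proof -
    have "card (\<Union>j<L. Y \<inter> B j) = (\<Sum>j<L. card (Y \<inter> B j))"
      using disjoint_B finY unfolding disjoint_family_on_def
      by (intro card_UN_disjoint) auto
    then show ?thesis by simp
  qed
  also have "\<dots> \<le> card Y" using finY by (intro of_nat_mono card_mono) auto
  finally have Wk: "W \<le> k" using Y by linarith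
  have W0: "0 \<le> W" unfolding W_def using w0 by (simp add: sum_nonneg)
  have ind: "(\<Sum>v\<in>V. indicator A v) = real (card A)" if "A \<subseteq> V" for A
    using that finite_V by (simp add: indicator_def sum.If_cases Int_absorb1)
  have sum_y: "(\<Sum>v\<in>V. y v) = W * b"
  proof -
    have "(\<Sum>v\<in>V. y v) = (\<Sum>j<L. w j * (\<Sum>v\<in>V. indicator (C j) v))"
      unfolding y by (subst sum.swap) (simp add: sum_distrib_left)
    then show ?thesis unfolding W_def sum_distrib_right using ind C_subset card_C by simp
  qed
  \<comment> \<open>Second moment: expanding the square turns it into pairwise intersections of
    labels.\<close>
  have "(\<Sum>v\<in>V. (y v)\<^sup>2) = (\<Sum>v\<in>V. \<Sum>i<L. \<Sum>j<L. w i * w j * indicator (C i \<inter> C j) v)"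
    unfolding y power2_eq_square sum_product
    by (intro sum.cong refl) (simp add: indicator_inter_arith)
  also have "\<dots> = (\<Sum>i<L. \<Sum>v\<in>V. \<Sum>j<L. w i * w j * indicator (C i \<inter> C j) v)"
    by (rule sum.swap)
  also have "\<dots> = (\<Sum>i<L. \<Sum>j<L. \<Sum>v\<in>V. w i * w j * indicator (C i \<inter> C j) v)"
    by (rule sum.cong[OF refl], rule sum.swap)
  also have "\<dots> = (\<Sum>i<L. \<Sum>j<L. w i * w j * (\<Sum>v\<in>V. indicator (C i \<inter> C j) v))"
    by (simp only: sum_distrib_left)
  also have "\<dots> = (\<Sum>i<L. \<Sum>j<L. w i * w j * card (C i \<inter> C j))"
    using C_subset by (intro sum.cong refl) (auto simp: ind subset_iff)
  also have "\<dots> \<le> (\<Sum>i<L. \<Sum>j<L. w i * w j * (b / a + h * b) + (if j = i then w i * (t * b) else 0))"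
  proof (intro sum_mono)
    fix i j assume ij: "i \<in> {..<L}" "j \<in> {..<L}"
    show "w i * w j * card (C i \<inter> C j) \<le>
      w i * w j * (b / a + h * b) + (if j = i then w i * (t * b) else 0)"
    proof (cases "j = i")
      case True
      \<comment> \<open>On the diagonal the overlap is all of \<open>b\<close>; this is where the
        cap enters, as it bounds one factor \<open>w i\<close> by \<open>t\<close>.\<close>
      have "w i * w i * b \<le> w i * (t * b)"
        using w0[of i] wt[of i] by (simp add: mult.assoc mult_left_mono mult_right_mono)
      moreover have "0 \<le> w i * w i * (b / a + h * b)" using w0 h by simp
      ultimately show ?thesis using True ij card_C by simp
    next
      case False
      then show ?thesis using overlap[of i j] ij w0 by (auto intro!: mult_left_mono)
    qed
  qed
  also have "\<dots> = W\<^sup>2 * (b / a + h * b) + W * (t * b)"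
    unfolding sum.distrib W_def power2_eq_square sum_product
    by (simp add: sum_distrib_right sum_distrib_left)
  finally have sq: "(\<Sum>v\<in>V. (y v)\<^sup>2) \<le> W\<^sup>2 * (b / a + h * b) + W * (t * b)" .
  \<comment> \<open>\<open>W / a\<close> is the mean of \<open>y\<close> over \<open>V\<close>, so
    the sum of these squares is \<open>card V\<close> times the variance.\<close>
  have "(y v - W / a)\<^sup>2 = (y v)\<^sup>2 - 2 * W / a * y v + (W / a)\<^sup>2" for v
    by (simp add: power2_diff)
  then have "(\<Sum>v\<in>V. (y v - W / a)\<^sup>2)
      = (\<Sum>v\<in>V. (y v)\<^sup>2) - 2 * W / a * (\<Sum>v\<in>V. y v) + (\<Sum>v\<in>V. (W / a)\<^sup>2)"
    by (simp only: sum.distrib sum_subtractf sum_distrib_left)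
  also have "\<dots> = (\<Sum>v\<in>V. (y v)\<^sup>2) - W\<^sup>2 * b / a"
    unfolding sum_y using card_V a_pos by (simp add: power2_eq_square field_simps)
  also have "\<dots> \<le> W\<^sup>2 * (h * b) + W * (t * b)" using sq by (simp add: algebra_simps)
  also have "\<dots> \<le> k\<^sup>2 * (h * b) + k * (t * b)"
    using Wk W0 h by (intro add_mono mult_right_mono power_mono) (auto intro: mult_right_mono)
  finally have var: "(\<Sum>v\<in>V. (y v - W / a)\<^sup>2) \<le> b * (t * k + h * k\<^sup>2)"
    by (simp add: algebra_simps)
  let ?U = "V - Y"
  \<comment> \<open>Cauchy-Schwarz passes from the variance over \<open>V\<close> to the deviation
    on the subset \<open>V - Y\<close>, whichever it is; the factor \<open>card V = a * b\<close>
    accounts for the \<open>a\<close> in the assumption on \<open>\<nu>\<close>.\<close>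
  have "(\<Sum>v\<in>?U. y v - W / a)\<^sup>2 \<le> card ?U * (\<Sum>v\<in>?U. (y v - W / a)\<^sup>2)"
    using sum_squared_le_sum_of_squares[of "\<lambda>v. y v - W / a" ?U] by (simp add: mult.commute)
  also have "\<dots> \<le> card V * (\<Sum>v\<in>V. (y v - W / a)\<^sup>2)"
  proof (rule mult_mono)
    show "real (card ?U) \<le> card V" using finite_V by (simp add: card_mono)
    show "(\<Sum>v\<in>?U. (y v - W / a)\<^sup>2) \<le> (\<Sum>v\<in>V. (y v - W / a)\<^sup>2)"
      using finite_V by (intro sum_mono2) auto
  qed (auto simp: sum_nonneg)
  also have "\<dots> \<le> card V * (b * (t * k + h * k\<^sup>2))"
    using var by (intro mult_left_mono) auto
  also have "\<dots> = b\<^sup>2 * (a * (t * k + h * k\<^sup>2))"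
    unfolding card_V by (simp add: power2_eq_square algebra_simps)
  also have "\<dots> \<le> b\<^sup>2 * (\<nu> * k)\<^sup>2" using \<nu> by (intro mult_left_mono) auto
  also have "\<dots> = (b * \<nu> * k)\<^sup>2" by (simp add: power_mult_distrib)
  finally have "(\<Sum>v\<in>?U. y v - W / a) \<le> b * \<nu> * k"
    by (rule power2_le_imp_le) (use \<nu> in simp)
  then have "(\<Sum>v\<in>?U. y v) \<le> card ?U * (W / a) + b * \<nu> * k"
    by (simp add: sum_subtractf)
  also have "\<dots> \<le> card ?U * (k / a) + b * \<nu> * k"
    using Wk by (intro add_right_mono mult_left_mono divide_right_mono) auto
  finally have sumU: "(\<Sum>v\<in>?U. y v) / q \<le> card ?U * (1 / a) * (k / q) + b * \<nu> * (k / q)"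
    using divide_right_mono[of "\<Sum>v\<in>?U. y v" "card ?U * (k / a) + b * \<nu> * k" "real q"]
    by (simp add: add_divide_distrib mult.commute)
  have UY: "card ?U + card (Y \<inter> V) = a * b"
    using card_Diff_subset_Int[of V Y] card_mono[OF finite_V, of "V \<inter> Y"] finite_V card_V
    by (simp add: Int_commute)
  \<comment> \<open>As \<open>k / q \<ge> 1\<close>, the points taken may be weighted by
    \<open>k / q\<close> as well; taken and omitted points together make up
    \<open>a * b\<close>.\<close>
  have kq: "1 \<le> real k / q" using k q_pos by simp
  have "F (\<lambda>_. t) Y \<le> (\<Sum>v\<in>?U. y v / q) + card (Y \<inter> V) / a"
    unfolding F_def y_def by (intro add_mono sum_mono) auto
  also have "\<dots> \<le> card ?U * (1 / a) * (k / q) + b * \<nu> * (k / q) + card (Y \<inter> V) * (1 / a) * (k / q)"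
    using sumU kq mult_left_mono[OF kq, of "card (Y \<inter> V) * (1 / real a)"]
    by (simp add: sum_divide_distrib)
  also have "\<dots> = (card ?U + card (Y \<inter> V)) * (1 / a) * (k / q) + b * \<nu> * (k / q)"
    by (simp add: algebra_simps)
  also have "\<dots> = b * (k / q) + b * \<nu> * (k / q)"
    unfolding UY using a_pos by simp
  finally show ?thesis by (simp add: algebra_simps add_divide_distrib)
qed

end

section \<open>Runs of streaming algorithms\<close>

abbreviation stream :: "'a list \<Rightarrow> 'a option list" where
  "stream \<sigma> \<equiv> map Some \<sigma> @ [None]"

lemma run_Halted_mono:
  assumes "run A f \<sigma> \<omega> T = Halted Y" "T \<le> T'"
  shows "run A f \<sigma> \<omega> T' = Halted Y"
  using assms(2,1) by (induction rule: dec_induct) auto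

lemma run_Halted_unique:
  assumes "run A f \<sigma> \<omega> T = Halted Y" "run A f \<sigma> \<omega> T' = Halted Y'"
  shows "Y = Y'"
  using run_Halted_mono[OF assms(1), of T'] run_Halted_mono[OF assms(2), of T] assms
  by (cases "T \<le> T'") auto

lemma outcome_SomeD:
  assumes "outcome A f \<sigma> \<omega> = Some Y"
  shows "\<exists>T. run A f \<sigma> \<omega> T = Halted Y"
proof -
  obtain T Y' where T: "run A f \<sigma> \<omega> T = Halted Y'"
    using assms unfolding outcome_def by (auto split: if_splits)
  then have "(THE Y. \<exists>t. run A f \<sigma> \<omega> t = Halted Y) = Y'"
    using run_Halted_unique by (intro the_equality) blast+
  then show ?thesis using T assms unfolding outcome_def by (auto split: if_splits)
qed

lemma outcome_cong:
  assumes "\<And>t. run A f \<sigma> \<omega> t = run A f' \<sigma> \<omega> t"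
  shows "outcome A f \<sigma> \<omega> = outcome A f' \<sigma> \<omega>"
  unfolding outcome_def assms ..

locale stream_run =
  fixes E :: "'a set" and A :: "('a, 'i, 'r) stream_algorithm" and f :: "'a set \<Rightarrow> real"
    and \<sigma> :: "'a list" and \<omega> :: "nat \<Rightarrow> 'r"
  assumes alg: "stream_algorithm_on E A"
    and set_stream: "set \<sigma> = E"
begin

abbreviation "R \<equiv> run A f \<sigma> \<omega>"

text \<open>The position is the number of signals consumed, so it can reach
  \<open>Suc (length \<sigma>)\<close>: the end-of-stream signal counts but brings no element, hence
  the condition \<open>l < length \<sigma>\<close>. Only the arriving element can enter the memory,
  and a query consumes nothing.\<close>

lemma run_Suc_Running:
  assumes R: "R T = Running (drop i (stream \<sigma>)) s" and s: "fst s \<subseteq> E" and i: "i \<le> Suc (length \<sigma>)"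
    and R': "R (Suc T) = Running es' s'"
  obtains i' where "i \<le> i'" "i' \<le> Suc i" "i' \<le> Suc (length \<sigma>)" "es' = drop i' (stream \<sigma>)"
    "fst s' \<subseteq> E" "fst s' \<subseteq> fst s \<union> (!) \<sigma> ` {l. i \<le> l \<and> l < i' \<and> l < length \<sigma>}"
proof (cases "action_of A (\<omega> T) s")
  case (Query S next_mem)
  have es: "es' = drop i (stream \<sigma>)" "s' = next_mem (f S)" using R R' Query by auto
  obtain M w where Mw: "s = (M, w)" by (cases s)
  have "\<forall>x. fst (next_mem x) \<subseteq> M"
    using alg s Query unfolding stream_algorithm_on_def Mw by (metis fst_conv)
  then have "fst s' \<subseteq> fst s" using es Mw by auto
  then show ?thesis using s i es(1) by (intro that[of i]) auto
next
  case Proceed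
  then obtain e where e: "drop i (stream \<sigma>) = e # es'" and s': "s' = receive A (\<omega> T) e s"
    using R R' by (auto split: list.splits)
  have il: "i < length (stream \<sigma>)" using e by (metis drop_all linorder_not_le list.distinct(1))
  have e': "e = stream \<sigma> ! i" "es' = drop (Suc i) (stream \<sigma>)"
    using e Cons_nth_drop_Suc[OF il] by auto
  obtain M w where Mw: "s = (M, w)" by (cases s)
  show ?thesis
  proof (cases "i < length \<sigma>")
    case True
    then have eq: "e = Some (\<sigma> ! i)" using e' by (simp add: nth_append)
    have "\<sigma> ! i \<in> E" using True set_stream by auto
    then have sub: "fst s' \<subseteq> insert (\<sigma> ! i) M"
      using alg s unfolding stream_algorithm_on_def Mw s' eq by simp
    have "i \<in> {l. i \<le> l \<and> l < Suc i \<and> l < length \<sigma>}" using True by auto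
    then have "\<sigma> ! i \<in> (!) \<sigma> ` {l. i \<le> l \<and> l < Suc i \<and> l < length \<sigma>}" by (rule imageI)
    then show ?thesis using sub s \<open>\<sigma> ! i \<in> E\<close> True e'(2) Mw
      by (intro that[of "Suc i"]) auto
  next
    case False
    then have eq: "e = None" using e' il by (simp add: nth_append)
    have "fst s' \<subseteq> M"
      using alg s unfolding stream_algorithm_on_def Mw s' eq by simp
    then show ?thesis using s e'(2) il Mw
      by (intro that[of "Suc i"]) auto
  qed
qed

lemma run_Running_pred:
  assumes "R (Suc T) = Running es s"
  obtains es' s' where "R T = Running es' s'"
  using assms by (cases "R T") auto

lemma run_Running_drop:
  assumes "R T = Running es s"
  shows "\<exists>i\<le>Suc (length \<sigma>). es = drop i (stream \<sigma>) \<and> fst s \<subseteq> E"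
  using assms
proof (induction T arbitrary: es s)
  case 0
  then show ?case by (intro exI[of _ 0]) auto
next
  case (Suc T)
  obtain es' s' where R: "R T = Running es' s'" using run_Running_pred[OF Suc.prems] .
  from Suc.IH[OF this] obtain i where i: "i \<le> Suc (length \<sigma>)" "es' = drop i (stream \<sigma>)" "fst s' \<subseteq> E"
    by (elim exE conjE)
  obtain i' where "i' \<le> Suc (length \<sigma>)" "es = drop i' (stream \<sigma>)" "fst s \<subseteq> E"
    by (rule run_Suc_Running[OF R[unfolded i(2)] i(3,1) Suc.prems])
  then show ?case by (intro exI[of _ i'] conjI)
qed

lemma drop_stream_eq:
  assumes "drop i (stream \<sigma>) = drop j (stream \<sigma>)" "i \<le> Suc (length \<sigma>)" "j \<le> Suc (length \<sigma>)"
  shows "i = j"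
  using arg_cong[OF assms(1), of length] assms(2,3) by auto

text \<open>Memory can only be refilled from arrivals: what is stored at \<open>T\<close> was stored
  at \<open>T0\<close> or has arrived in between.\<close>

lemma run_between:
  assumes "T0 \<le> T" "R T = Running (drop i (stream \<sigma>)) s" "i \<le> Suc (length \<sigma>)"
  shows "\<exists>i0 s0. i0 \<le> i \<and> R T0 = Running (drop i0 (stream \<sigma>)) s0 \<and>
    fst s \<subseteq> fst s0 \<union> (!) \<sigma> ` {l. i0 \<le> l \<and> l < i \<and> l < length \<sigma>}"
  using assms
proof (induction arbitrary: i s rule: dec_induct)
  case base
  then show ?case by (intro exI[of _ i]) auto
next
  case (step T)
  obtain es' s' where R': "R T = Running es' s'" using run_Running_pred[OF step.prems(1)] .
  obtain i' where i': "i' \<le> Suc (length \<sigma>)" "es' = drop i' (stream \<sigma>)" "fst s' \<subseteq> E"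
    using run_Running_drop[OF R'] by (elim exE conjE)
  obtain i'' where
    i'': "i' \<le> i''" "i'' \<le> Suc (length \<sigma>)" "drop i (stream \<sigma>) = drop i'' (stream \<sigma>)"
    "fst s \<subseteq> fst s' \<union> (!) \<sigma> ` {l. i' \<le> l \<and> l < i'' \<and> l < length \<sigma>}"
    by (rule run_Suc_Running[OF R'[unfolded i'(2)] i'(3,1) step.prems(1)])
  have "i'' = i" using drop_stream_eq[OF i''(3) step.prems(2) i''(2)] by simp
  obtain i0 s0 where i0: "i0 \<le> i'" "R T0 = Running (drop i0 (stream \<sigma>)) s0"
    "fst s' \<subseteq> fst s0 \<union> (!) \<sigma> ` {l. i0 \<le> l \<and> l < i' \<and> l < length \<sigma>}"
    using step.IH[OF R'[unfolded i'(2)] i'(1)] by (elim exE conjE)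
  show ?case
  proof (intro exI[of _ i0] exI[of _ s0] conjI)
    show "i0 \<le> i" using i0 i'' \<open>i'' = i\<close> by simp
    show "fst s \<subseteq> fst s0 \<union> (!) \<sigma> ` {l. i0 \<le> l \<and> l < i \<and> l < length \<sigma>}"
      using i0(1,3) i''(1,4) \<open>i'' = i\<close> by fastforce
  qed (rule i0(2))
qed

text \<open>The position advances by at most one per step, so it passes through every smaller
  value.\<close>

lemma run_earlier:
  assumes "R T = Running (drop i (stream \<sigma>)) s" "i0 \<le> i" "i \<le> Suc (length \<sigma>)"
  shows "\<exists>T0\<le>T. \<exists>s0. R T0 = Running (drop i0 (stream \<sigma>)) s0"
  using assms
proof (induction T arbitrary: i s)
  case 0
  then have "drop 0 (stream \<sigma>) = drop i (stream \<sigma>)"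
    unfolding run.simps drop_0 by (simp only: config.inject)
  then have "0 = i" by (rule drop_stream_eq[OF _ le0 0(3)])
  then have "i0 = i" using 0(2) by simp
  show ?case using 0(1) unfolding \<open>i0 = i\<close> by (intro exI[of _ 0] exI[of _ s] conjI le0)
next
  case (Suc T)
  obtain es' s' where R': "R T = Running es' s'" using run_Running_pred[OF Suc.prems(1)] .
  obtain i' where i': "i' \<le> Suc (length \<sigma>)" "es' = drop i' (stream \<sigma>)" "fst s' \<subseteq> E"
    using run_Running_drop[OF R'] by (elim exE conjE)
  obtain i'' where
    i'': "i' \<le> i''" "i'' \<le> Suc i'" "i'' \<le> Suc (length \<sigma>)" "drop i (stream \<sigma>) = drop i'' (stream \<sigma>)"
    by (rule run_Suc_Running[OF R'[unfolded i'(2)] i'(3,1) Suc.prems(1)])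
  have "i'' = i" using drop_stream_eq[OF i''(4) Suc.prems(3) i''(3)] by simp
  show ?case
  proof (cases "i0 = i")
    case True
    show ?thesis using Suc.prems(1) unfolding True by (intro exI[of _ "Suc T"] exI[of _ s] conjI) simp_all
  next
    case False
    then have "i0 \<le> i'" using Suc.prems(2) i'' \<open>i'' = i\<close> by simp
    from Suc.IH[OF R'[unfolded i'(2)] this i'(1)] obtain T0 s0
      where "T0 \<le> T" "R T0 = Running (drop i0 (stream \<sigma>)) s0" by (elim exE conjE)
    then show ?thesis by (intro exI[of _ T0] exI[of _ s0] conjI) simp_all
  qed
qed

text \<open>
  If a block has more than \<open>2 r\<close> elements in memory although no window of \<open>w\<close> consecutive arrivals
  contains more than \<open>r\<close> of them, then more than \<open>r\<close> of them were in memory already at the start of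
  the current window, and then only few blocks compete for the memory.
\<close>
lemma card_rich_blocks:
  fixes B :: "nat \<Rightarrow> 'a set"
  assumes mem: "\<And>T es s. R T = Running es s \<Longrightarrow> card (fst s) \<le> m"
    and disj: "disjoint_family_on B {..<L}" and fin: "finite E" and w: "0 < w"
    and D: "D = {J. J < L \<and> (\<exists>T es s. R T = Running es s \<and> 2 * r < card (fst s \<inter> B J))}"
    and W: "W = {J. J < L \<and> (\<exists>c. r < card {l. l < length \<sigma> \<and> l div w = c \<and> \<sigma> ! l \<in> B J})}"
  shows "card (D - W) * Suc r \<le> Suc (Suc (length \<sigma>) div w) * m"
proof -
  \<comment> \<open>One snapshot per window start suffices: the first moment at which the position
    is \<open>c * w\<close>. There are few snapshots, although a run may query for arbitrarily many
    steps.\<close>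
  define reach where "reach c T \<longleftrightarrow> (\<exists>s. R T = Running (drop (c * w) (stream \<sigma>)) s)" for c T
  define X where "X c = {J. J < L \<and> (\<exists>es s. R (LEAST T. reach c T) = Running es s \<and>
      Suc r \<le> card (fst s \<inter> B J))}" for c
  have cardX: "card (X c) * Suc r \<le> m" for c
  proof (cases "\<exists>es s. R (LEAST T. reach c T) = Running es s")
    case True
    then obtain es s where s: "R (LEAST T. reach c T) = Running es s" by auto
    have fins: "finite (fst s)" using run_Running_drop[OF s] fin finite_subset by auto
    have X: "X c = {J. J < L \<and> Suc r \<le> card (fst s \<inter> B J)}" unfolding X_def using s by auto
    \<comment> \<open>Disjoint blocks, each with more than \<open>r\<close> stored elements, share a
      memory of at most \<open>m\<close>.\<close>
    have "card (X c) * Suc r = (\<Sum>J\<in>X c. Suc r)" by simp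
    also have "\<dots> \<le> (\<Sum>J\<in>X c. card (fst s \<inter> B J))" using X by (intro sum_mono) auto
    also have "\<dots> = card (\<Union>J\<in>X c. fst s \<inter> B J)"
      using disj fins X unfolding disjoint_family_on_def
      by (intro card_UN_disjoint[symmetric]) auto
    also have "\<dots> \<le> card (fst s)" using fins by (intro card_mono) auto
    finally show ?thesis using mem[OF s] by simp
  next
    case False
    then have "X c = {}" unfolding X_def by auto
    then show ?thesis by simp
  qed
  have "D - W \<subseteq> (\<Union>c\<in>{..Suc (length \<sigma>) div w}. X c)"
  proof
    fix J assume J: "J \<in> D - W"
    then obtain T es s where s: "R T = Running es s" "2 * r < card (fst s \<inter> B J)" and JL: "J < L"
      unfolding D by auto
    obtain i where i: "i \<le> Suc (length \<sigma>)" "es = drop i (stream \<sigma>)" using run_Running_drop[OF s(1)] by auto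
    define c where "c = i div w"
    have cw: "c * w \<le> i" unfolding c_def by simp
    obtain T0 where T0: "T0 \<le> T" "reach c T0"
      using run_earlier[of T i s "c * w"] s i cw unfolding reach_def by auto
    define T1 where "T1 = (LEAST T. reach c T)"
    have T1: "reach c T1" "T1 \<le> T" unfolding T1_def using T0 by (auto intro: LeastI Least_le order_trans)
    obtain i1 s1 where i1: "i1 \<le> i" "R T1 = Running (drop i1 (stream \<sigma>)) s1"
      "fst s \<subseteq> fst s1 \<union> (!) \<sigma> ` {l. i1 \<le> l \<and> l < i \<and> l < length \<sigma>}"
      using run_between[OF T1(2), of i s] s i by auto
    \<comment> \<open>The snapshot has position exactly \<open>c * w\<close>, so all arrivals since
      then lie in window \<open>c\<close>.\<close>
    have "i1 = c * w"
      using T1(1) i1(1,2) cw i(1) drop_stream_eq[of i1 "c * w"] unfolding reach_def by auto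
    let ?N = "{l. l < length \<sigma> \<and> l div w = c \<and> \<sigma> ! l \<in> B J}"
    have "l div w = c" if "c * w \<le> l" "l < i" for l
    proof -
      have "c = c * w div w" using w by simp
      also have "\<dots> \<le> l div w" using that by (intro div_le_mono)
      finally have "c \<le> l div w" .
      moreover have "l div w \<le> c" unfolding c_def using that by (intro div_le_mono) simp
      ultimately show ?thesis by simp
    qed
    then have "fst s \<inter> B J \<subseteq> (fst s1 \<inter> B J) \<union> (!) \<sigma> ` ?N"
      using i1(3) \<open>i1 = c * w\<close> by blast
    moreover have fin1: "finite (fst s1)" using run_Running_drop[OF i1(2)] fin finite_subset by auto
    ultimately have "card (fst s \<inter> B J) \<le> card ((fst s1 \<inter> B J) \<union> (!) \<sigma> ` ?N)"
      by (intro card_mono) auto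
    also have "\<dots> \<le> card (fst s1 \<inter> B J) + card ((!) \<sigma> ` ?N)" by (rule card_Un_le)
    also have "card ((!) \<sigma> ` ?N) \<le> card ?N" by (intro card_image_le) auto
    \<comment> \<open>\<open>J\<close> is not in \<open>W\<close>, so these arrivals account for at
      most \<open>r\<close> of the more than \<open>2 * r\<close> elements; the snapshot held the
      rest.\<close>
    also have "card ?N \<le> r" using J JL unfolding W by (auto simp: not_less)
    finally have "Suc r \<le> card (fst s1 \<inter> B J)" using s(2) by simp
    then have "J \<in> X c" unfolding X_def T1_def[symmetric] using JL i1(2) by auto
    moreover have "c \<le> Suc (length \<sigma>) div w" unfolding c_def using i(1) by (rule div_le_mono)
    ultimately show "J \<in> (\<Union>c\<in>{..Suc (length \<sigma>) div w}. X c)" by auto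
  qed
  moreover have "finite (X c)" for c unfolding X_def by auto
  ultimately have "card (D - W) \<le> card (\<Union>c\<in>{..Suc (length \<sigma>) div w}. X c)"
    by (intro card_mono) auto
  also have "\<dots> \<le> (\<Sum>c\<in>{..Suc (length \<sigma>) div w}. card (X c))" by (rule card_UN_le) simp
  finally have "card (D - W) * Suc r \<le> (\<Sum>c\<in>{..Suc (length \<sigma>) div w}. card (X c)) * Suc r"
    by (rule mult_right_mono) simp
  also have "\<dots> \<le> (\<Sum>c\<in>{..Suc (length \<sigma>) div w}. m)"
    unfolding sum_distrib_right using cardX by (intro sum_mono)
  finally show ?thesis by simp
qed

end

text \<open>A run sees the function only through the answers to its queries, which stay inside the
  memory. By induction the two runs have the same memory, so it suffices to compare the functions on
  sets stored along the run on \<open>f\<close>.\<close>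

lemma run_eq_if_queries_eq:
  assumes alg: "stream_algorithm_on E A" and \<sigma>: "set \<sigma> = E"
    and eq: "\<And>T es s S. run A f \<sigma> \<omega> T = Running es s \<Longrightarrow> S \<subseteq> fst s \<Longrightarrow> f' S = f S"
  shows "run A f' \<sigma> \<omega> T = run A f \<sigma> \<omega> T"
proof (induction T)
  case (Suc T)
  interpret stream_run E A f \<sigma> \<omega> using alg \<sigma> by unfold_locales
  show ?case
  proof (cases "run A f \<sigma> \<omega> T")
    case (Running es s)
    then have s: "fst s \<subseteq> E" using run_Running_drop by blast
    obtain M v where Mv: "s = (M, v)" by (cases s)
    have "f' S = f S" if "action_of A (\<omega> T) s = Query S next_mem" for S next_mem
    proof (rule eq[OF Running])
      show "S \<subseteq> fst s" using alg s that unfolding stream_algorithm_on_def Mv by auto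
    qed
    then show ?thesis using Suc Running by (auto split: action.splits list.splits)
  qed (use Suc in auto)
qed simp

lemma outcome_bounds:
  assumes strong: "strong_algorithm E k A" and \<sigma>: "set \<sigma> = E"
    and out: "outcome A f \<sigma> \<omega> = Some Y"
  shows "Y \<subseteq> E \<and> card Y \<le> k"
proof -
  interpret stream_run E A f \<sigma> \<omega> using strong \<sigma> unfolding strong_algorithm_def by unfold_locales auto
  obtain T where "R T = Halted Y" using outcome_SomeD[OF out] by auto
  then show ?thesis
  proof (induction T)
    case (Suc T)
    show ?case
    proof (cases "R T")
      case (Running es s)
      obtain M v where Mv: "s = (M, v)" by (cases s)
      have "M \<subseteq> E" using run_Running_drop[OF Running] Mv by auto
      moreover have "Y = output_of A (\<omega> T) s"
        using Suc.prems Running by (auto split: action.splits list.splits)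
      ultimately show ?thesis using strong Mv unfolding strong_algorithm_def by simp
    qed (use Suc in auto)
  qed simp
qed

section \<open>Random arrival orders\<close>

definition same_window :: "nat \<Rightarrow> 'a list \<Rightarrow> 'a \<Rightarrow> 'a \<Rightarrow> bool" where
  "same_window w \<sigma> x y \<longleftrightarrow> (\<exists>l l'. l < length \<sigma> \<and> l' < length \<sigma> \<and> l div w = l' div w \<and> \<sigma> ! l = x \<and> \<sigma> ! l' = y)"

lemma sum_card_filter_swap:
  assumes "finite X" "finite Y"
  shows "(\<Sum>x\<in>X. card {y \<in> Y. Q x y}) = (\<Sum>y\<in>Y. card {x \<in> X. Q x y})"
proof -
  have "(\<Sum>x\<in>X. card {y \<in> Y. Q x y}) = (\<Sum>x\<in>X. \<Sum>y\<in>Y. if Q x y then 1 else 0)"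
    using assms by (simp add: sum.If_cases Int_def)
  also have "\<dots> = (\<Sum>y\<in>Y. \<Sum>x\<in>X. if Q x y then 1 else 0)" by (rule sum.swap)
  also have "\<dots> = (\<Sum>y\<in>Y. card {x \<in> X. Q x y})"
    using assms by (simp add: sum.If_cases Int_def)
  finally show ?thesis .
qed

text \<open>Renaming the elements by a permutation of \<open>E\<close> that carries \<open>x\<close>
  to \<open>x'\<close> and \<open>y\<close> to \<open>y'\<close> keeps every position, so it maps
  the orders counted on the left injectively to those on the right. Since the pairs are arbitrary,
  all pairs have the same count.\<close>

lemma card_same_window_mono:
  assumes "x \<in> E" "y \<in> E" "x \<noteq> y" "x' \<in> E" "y' \<in> E" "x' \<noteq> y'"
  shows "card {\<sigma> \<in> permutations_of_set E. same_window w \<sigma> x y}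
    \<le> card {\<sigma> \<in> permutations_of_set E. same_window w \<sigma> x' y'}"
proof -
  \<comment> \<open>\<open>y1\<close> is where \<open>y\<close> lands once \<open>x\<close> and
    \<open>x'\<close> are swapped. As \<open>y1\<close> and \<open>y'\<close> both differ from
    \<open>x'\<close>, the second swap does not move \<open>x'\<close>.\<close>
  define y1 where "y1 = Transposition.transpose x x' y"
  define \<tau> where "\<tau> = Transposition.transpose y1 y' \<circ> Transposition.transpose x x'"
  have y1: "y1 \<in> E" "y1 \<noteq> x'"
    unfolding y1_def using assms by (auto simp: Transposition.transpose_def)
  have \<tau>: "\<tau> permutes E"
    unfolding \<tau>_def using assms y1 by (intro permutes_compose permutes_swap_id)
  have \<tau>xy: "\<tau> x = x'" "\<tau> y = y'"
    unfolding \<tau>_def using y1 assms by (auto simp: y1_def[symmetric])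
  have inj: "inj \<tau>" using \<tau> by (rule permutes_inj)
  show ?thesis
  proof (rule card_inj_on_le)
    show "inj_on (map \<tau>) {\<sigma> \<in> permutations_of_set E. same_window w \<sigma> x y}"
      using inj by (meson inj_mapI inj_on_subset subset_UNIV)
    show "map \<tau> ` {\<sigma> \<in> permutations_of_set E. same_window w \<sigma> x y}
        \<subseteq> {\<sigma> \<in> permutations_of_set E. same_window w \<sigma> x' y'}"
    proof
      fix \<sigma>' assume "\<sigma>' \<in> map \<tau> ` {\<sigma> \<in> permutations_of_set E. same_window w \<sigma> x y}"
      then obtain \<sigma> where \<sigma>: "\<sigma>' = map \<tau> \<sigma>" "\<sigma> \<in> permutations_of_set E" "same_window w \<sigma> x y" by auto
      have "\<sigma>' \<in> permutations_of_set E"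
        using permutations_of_set_image_permutes[OF \<tau>] \<sigma>(1,2) by blast
      moreover have "same_window w \<sigma>' x' y'"
      proof -
        obtain l l' where "l < length \<sigma>" "l' < length \<sigma>" "l div w = l' div w" "\<sigma> ! l = x" "\<sigma> ! l' = y"
          using \<sigma>(3) unfolding same_window_def by (elim exE conjE)
        then show ?thesis
          unfolding same_window_def \<sigma>(1) using \<tau>xy by (intro exI[of _ l] exI[of _ l']) simp
      qed
      ultimately show "\<sigma>' \<in> {\<sigma> \<in> permutations_of_set E. same_window w \<sigma> x' y'}" by simp
    qed
  qed simp
qed

lemma card_window:
  assumes "0 < w"
  shows "card {l'. l' < n \<and> l' div w = (c::nat)} \<le> w" "finite {l'. l' < n \<and> l' div w = (c::nat)}"
proof -
  have "{l'. l' < n \<and> l' div w = c} \<subseteq> {c * w..<c * w + w}"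
  proof
    fix x assume "x \<in> {l'. l' < n \<and> l' div w = c}"
    then have "x = c * w + x mod w" using div_mult_mod_eq[of x w] by simp
    then show "x \<in> {c * w..<c * w + w}" using mod_less_divisor[OF assms, of x] by simp
  qed
  then show "card {l'. l' < n \<and> l' div w = c} \<le> w"
    using card_mono[of "{c * w..<c * w + w}"] by fastforce
qed simp

text \<open>Averaging over ordered pairs of distinct elements: all have the same count by symmetry,
  and in each order an element shares its window with at most \<open>w\<close> others. So a pair
  meets with probability at most \<open>w / (card E - 1)\<close>.\<close>

lemma card_same_window:
  fixes E :: "'a set"
  assumes fin: "finite E" and w: "0 < w" and xy: "x \<in> E" "y \<in> E" "x \<noteq> y"
  shows "card {\<sigma> \<in> permutations_of_set E. same_window w \<sigma> x y} * (card E - 1) \<le> fact (card E) * w"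
proof -
  let ?P = "permutations_of_set E"
  let ?N = "\<lambda>x y. card {\<sigma> \<in> ?P. same_window w \<sigma> x y}"
  have bound: "(\<Sum>x\<in>E. card {y \<in> E - {x}. same_window w \<sigma> x y}) \<le> card E * w" if \<sigma>: "\<sigma> \<in> ?P" for \<sigma>
  proof -
    have "card {y \<in> E - {x}. same_window w \<sigma> x y} \<le> w" if "x \<in> E" for x
    proof -
      have "x \<in> set \<sigma>" using that permutations_of_setD(1)[OF \<sigma>] by simp
      then obtain l where l: "l < length \<sigma>" "\<sigma> ! l = x" by (auto simp: in_set_conv_nth)
      have "l' = l" if "l' < length \<sigma>" "\<sigma> ! l' = x" for l'
        using permutations_of_setD(2)[OF \<sigma>] l that by (metis nth_eq_iff_index_eq)
      then have "{y \<in> E - {x}. same_window w \<sigma> x y} \<subseteq> (!) \<sigma> ` {l'. l' < length \<sigma> \<and> l' div w = l div w}"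
        unfolding same_window_def by fastforce
      then have "card {y \<in> E - {x}. same_window w \<sigma> x y} \<le> card ((!) \<sigma> ` {l'. l' < length \<sigma> \<and> l' div w = l div w})"
        by (intro card_mono) auto
      also have "\<dots> \<le> card {l'. l' < length \<sigma> \<and> l' div w = l div w}" by (intro card_image_le) simp
      also have "\<dots> \<le> w" by (rule card_window[OF w])
      finally show ?thesis .
    qed
    then show ?thesis using sum_bounded_above[of E _ w] by simp
  qed
  have "?N x y * (card E - 1) * card E = (\<Sum>x'\<in>E. \<Sum>y'\<in>E - {x'}. ?N x y)"
    using fin by simp
  also have "\<dots> \<le> (\<Sum>x'\<in>E. \<Sum>y'\<in>E - {x'}. ?N x' y')"
    using xy by (intro sum_mono card_same_window_mono) auto
  also have "\<dots> = (\<Sum>x'\<in>E. \<Sum>\<sigma>\<in>?P. card {y' \<in> E - {x'}. same_window w \<sigma> x' y'})"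
    using fin by (intro sum.cong refl sum_card_filter_swap[symmetric]) auto
  also have "\<dots> = (\<Sum>\<sigma>\<in>?P. \<Sum>x'\<in>E. card {y' \<in> E - {x'}. same_window w \<sigma> x' y'})"
    by (rule sum.swap)
  also have "\<dots> \<le> (\<Sum>\<sigma>\<in>?P. card E * w)" using bound by (intro sum_mono)
  also have "\<dots> = fact (card E) * w * card E" using fin by simp
  finally show ?thesis using xy fin by (metis card_gt_0_iff empty_iff mult_le_cancel2)
qed

text \<open>The same set as \<open>W\<close> in \<open>card_rich_blocks\<close>: the blocks whose
  stored part may grow by more than \<open>r\<close> within one window.\<close>

definition dense_blocks :: "nat \<Rightarrow> nat \<Rightarrow> (nat \<Rightarrow> 'a set) \<Rightarrow> nat \<Rightarrow> 'a list \<Rightarrow> nat set" where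
  "dense_blocks w r B L \<sigma> =
     {J. J < L \<and> (\<exists>c. r < card {l. l < length \<sigma> \<and> l div w = c \<and> \<sigma> ! l \<in> B J})}"

text \<open>Second moment bound: a dense block has at least \<open>r (r + 1)\<close> ordered pairs in a common window.\<close>
lemma sum_card_dense_blocks:
  fixes B :: "nat \<Rightarrow> 'a set"
  assumes fin: "finite E" and w: "0 < w"
    and B: "\<And>j. j < L \<Longrightarrow> B j \<subseteq> E" "\<And>j. j < L \<Longrightarrow> card (B j) = q"
  shows "(\<Sum>\<sigma>\<in>permutations_of_set E. card (dense_blocks w r B L \<sigma>)) * (r * Suc r) * (card E - 1)
    \<le> L * q * q * (fact (card E) * w)"
proof -
  let ?P = "permutations_of_set E"
  let ?N = "\<lambda>x y. card {\<sigma> \<in> ?P. same_window w \<sigma> x y}"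
  let ?c = "\<lambda>\<sigma> J. \<Sum>x\<in>B J. card {y \<in> B J - {x}. same_window w \<sigma> x y}"
  have finB: "finite (B j)" if "j < L" for j using B(1)[OF that] fin by (rule finite_subset)
  have pairs: "r * Suc r \<le> ?c \<sigma> J" if \<sigma>: "\<sigma> \<in> ?P" and J: "J \<in> dense_blocks w r B L \<sigma>" for \<sigma> J
  proof -
    obtain c where JL: "J < L" and c: "r < card {l. l < length \<sigma> \<and> l div w = c \<and> \<sigma> ! l \<in> B J}"
      using J unfolding dense_blocks_def by auto
    define N where "N = {l. l < length \<sigma> \<and> l div w = c \<and> \<sigma> ! l \<in> B J}"
    define A where "A = (!) \<sigma> ` N"
    have A: "A \<subseteq> B J" "finite A" unfolding A_def N_def by auto
    have "inj_on ((!) \<sigma>) N"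
      using permutations_of_setD(2)[OF \<sigma>] unfolding N_def by (auto simp: inj_on_def nth_eq_iff_index_eq)
    then have cardA: "Suc r \<le> card A" unfolding A_def using c by (simp add: card_image N_def)
    have in_window: "r \<le> card {y \<in> B J - {x}. same_window w \<sigma> x y}" if "x \<in> A" for x
    proof -
      have "r \<le> card (A - {x})" using cardA that A by simp
      also have "A - {x} \<subseteq> {y \<in> B J - {x}. same_window w \<sigma> x y}"
        using that unfolding A_def N_def same_window_def by blast
      then have "card (A - {x}) \<le> card {y \<in> B J - {x}. same_window w \<sigma> x y}"
        using finB[OF JL] by (intro card_mono) auto
      finally show ?thesis .
    qed
    have "r * Suc r \<le> card A * r" using mult_right_mono[OF cardA, of r] by (simp add: mult.commute)
    also have "\<dots> = (\<Sum>x\<in>A. r)" by simp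
    also have "\<dots> \<le> (\<Sum>x\<in>A. card {y \<in> B J - {x}. same_window w \<sigma> x y})"
      using in_window by (intro sum_mono)
    also have "\<dots> \<le> ?c \<sigma> J" using A finB[OF JL] by (intro sum_mono2) auto
    finally show ?thesis .
  qed
  have "(\<Sum>\<sigma>\<in>?P. card (dense_blocks w r B L \<sigma>)) * (r * Suc r) = (\<Sum>\<sigma>\<in>?P. \<Sum>J\<in>dense_blocks w r B L \<sigma>. r * Suc r)"
    unfolding sum_distrib_right by simp
  also have "\<dots> \<le> (\<Sum>\<sigma>\<in>?P. \<Sum>J\<in>dense_blocks w r B L \<sigma>. ?c \<sigma> J)"
    using pairs by (intro sum_mono) auto
  also have "\<dots> \<le> (\<Sum>\<sigma>\<in>?P. \<Sum>J<L. ?c \<sigma> J)"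
    by (intro sum_mono sum_mono2) (auto simp: dense_blocks_def)
  also have "\<dots> = (\<Sum>J<L. \<Sum>\<sigma>\<in>?P. ?c \<sigma> J)" by (rule sum.swap)
  also have "\<dots> = (\<Sum>J<L. \<Sum>x\<in>B J. \<Sum>\<sigma>\<in>?P. card {y \<in> B J - {x}. same_window w \<sigma> x y})"
    by (rule sum.cong[OF refl], rule sum.swap)
  also have "\<dots> = (\<Sum>J<L. \<Sum>x\<in>B J. \<Sum>y\<in>B J - {x}. ?N x y)"
    using finB by (intro sum.cong refl sum_card_filter_swap) auto
  finally have "(\<Sum>\<sigma>\<in>?P. card (dense_blocks w r B L \<sigma>)) * (r * Suc r) * (card E - 1)
      \<le> (\<Sum>J<L. \<Sum>x\<in>B J. \<Sum>y\<in>B J - {x}. ?N x y) * (card E - 1)"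
    by (rule mult_right_mono) simp
  also have "\<dots> = (\<Sum>J<L. \<Sum>x\<in>B J. \<Sum>y\<in>B J - {x}. ?N x y * (card E - 1))"
    unfolding sum_distrib_right ..
  also have "\<dots> \<le> (\<Sum>J<L. \<Sum>x\<in>B J. \<Sum>y\<in>B J. fact (card E) * w)"
  proof (rule sum_mono)
    fix J assume J: "J \<in> {..<L}"
    show "(\<Sum>x\<in>B J. \<Sum>y\<in>B J - {x}. ?N x y * (card E - 1)) \<le> (\<Sum>x\<in>B J. \<Sum>y\<in>B J. fact (card E) * w)"
    proof (rule sum_mono)
      fix x assume x: "x \<in> B J"
      have "(\<Sum>y\<in>B J - {x}. ?N x y * (card E - 1)) \<le> (\<Sum>y\<in>B J - {x}. fact (card E) * w)"
        using B(1) J x by (intro sum_mono card_same_window fin w) auto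
      also have "\<dots> \<le> (\<Sum>y\<in>B J. fact (card E) * w)" using finB J by (intro sum_mono2) auto
      finally show "(\<Sum>y\<in>B J - {x}. ?N x y * (card E - 1)) \<le> (\<Sum>y\<in>B J. fact (card E) * w)" .
    qed
  qed
  also have "\<dots> = L * q * q * (fact (card E) * w)" using B(2) by simp
  finally show ?thesis .
qed

section \<open>Expected values\<close>

text \<open>Measurability is part of \<open>stream_algorithm_on\<close>; boundedness holds because
  the output is a subset of the finite set \<open>E\<close>.\<close>

lemma integrable_value_of_outcome:
  assumes strong: "strong_algorithm E k A" and fin: "finite E" and \<sigma>: "\<sigma> \<in> permutations_of_set E"
    and f: "nonneg_submodular E f"
  shows "integrable (coins A) (\<lambda>\<omega>. value_of f (outcome A f \<sigma> \<omega>))"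
proof -
  have alg: "stream_algorithm_on E A" using strong unfolding strong_algorithm_def by auto
  interpret prob_space "coins A" using alg unfolding stream_algorithm_on_def by auto
  have "outcome A f \<sigma> \<in> measurable (coins A) (count_space UNIV)"
    using alg \<sigma> f unfolding stream_algorithm_on_def by blast
  then have meas: "(\<lambda>\<omega>. value_of f (outcome A f \<sigma> \<omega>)) \<in> borel_measurable (coins A)"
    by (rule measurable_compose) simp
  define c where "c = (\<Sum>Y\<in>Pow E. f Y)"
  have f0: "0 \<le> f Y" if "Y \<subseteq> E" for Y using f that unfolding nonneg_submodular_def by auto
  have c: "f Y \<le> c" if "Y \<subseteq> E" for Y
    unfolding c_def using that fin f0 by (intro member_le_sum) auto
  have "0 \<le> c" unfolding c_def using f0 by (intro sum_nonneg) auto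
  have "norm (value_of f (outcome A f \<sigma> \<omega>)) \<le> c" for \<omega>
  proof (cases "outcome A f \<sigma> \<omega>")
    case (Some Y)
    then have "Y \<subseteq> E" using outcome_bounds[OF strong permutations_of_setD(1)[OF \<sigma>]] by blast
    then show ?thesis using Some c f0 by (simp add: value_of_def)
  qed (use \<open>0 \<le> c\<close> in \<open>simp add: value_of_def\<close>)
  then show ?thesis using meas by (intro integrable_const_bound[of _ c]) auto
qed

lemma expected_value_eq:
  assumes "finite E"
  shows "expected_value E A f =
    (\<Sum>\<sigma>\<in>permutations_of_set E. \<integral>\<omega>. value_of f (outcome A f \<sigma> \<omega>) \<partial>coins A) / fact (card E)"
  unfolding expected_value_def using assms by (subst integral_pmf_of_set) auto

lemma opt_value_ge:
  assumes "finite E" "Y \<subseteq> E" "card Y \<le> k"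
  shows "f Y \<le> opt_value E k f"
  unfolding opt_value_def using assms by (intro Max_ge) auto

text \<open>
  An algorithm without memory only ever learns \<open>f {}\<close>, so it cannot tell whether a fixed
  element \<open>e\<close> is worthless or very valuable.
\<close>
lemma buffer_positive:
  fixes A :: "('a, 'i, 'r) stream_algorithm"
  assumes strong: "strong_algorithm E k A" and approx: "achieves_approximation (1 / 2 + \<epsilon>) E k A"
    and buf: "buffer_at_most element_cost E A m" and \<epsilon>: "0 < \<epsilon>" and k: "1 \<le> k"
    and E: "finite E" "E \<noteq> {}"
  shows "1 \<le> m"
proof (rule ccontr)
  assume "\<not> 1 \<le> m"
  then have m: "m = 0" by simp
  have alg: "stream_algorithm_on E A" using strong unfolding strong_algorithm_def by auto
  interpret prob_space "coins A" using alg unfolding stream_algorithm_on_def by auto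
  obtain e where e: "e \<in> E" using E by auto
  define f :: "real \<Rightarrow> 'a set \<Rightarrow> real" where "f c S = (if e \<in> S then c else 1)" for c S
  have sub: "nonneg_submodular E (f c)" if "0 \<le> c" for c
    unfolding nonneg_submodular_def submodular_on_def f_def using that by auto
  let ?P = "permutations_of_set E"
  have out: "outcome A (f c) \<sigma> \<omega> = outcome A (f 0) \<sigma> \<omega>" if \<sigma>: "\<sigma> \<in> ?P" and \<omega>: "\<omega> \<in> space (coins A)" for c \<sigma> \<omega>
  proof (rule outcome_cong, rule run_eq_if_queries_eq[OF alg permutations_of_setD(1)[OF \<sigma>]])
    fix T es s S assume R: "run A (f 0) \<sigma> \<omega> T = Running es s" and S: "S \<subseteq> fst s"
    interpret stream_run E A "f 0" \<sigma> \<omega>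
      using alg permutations_of_setD(1)[OF \<sigma>] by unfold_locales
    have "fst s \<subseteq> E" using run_Running_drop[OF R] by auto
    then have "finite (fst s)" using E(1) by (rule finite_subset)
    moreover have "card (fst s) \<le> 0"
      using buf R \<sigma> \<omega> sub[of 0] unfolding buffer_at_most_def element_cost_def m by blast
    ultimately have "S = {}" using S by auto
    then show "f c S = f 0 S" unfolding f_def by simp
  qed
  define I where "I c \<sigma> = (\<integral>\<omega>. value_of (f c) (outcome A (f c) \<sigma> \<omega>) \<partial>coins A)" for c \<sigma>
  have EV: "expected_value E A (f c) = (\<Sum>\<sigma>\<in>?P. I c \<sigma>) / fact (card E)" for c
    unfolding I_def by (rule expected_value_eq[OF E(1)])
  have int: "integrable (coins A) (\<lambda>\<omega>. value_of (f c) (outcome A (f c) \<sigma> \<omega>))"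
    if "0 \<le> c" "\<sigma> \<in> ?P" for c \<sigma>
    using integrable_value_of_outcome[OF strong E(1) that(2) sub[OF that(1)]] .
  \<comment> \<open>The output does not depend on \<open>c\<close> and its value is affine in
    \<open>c\<close>, so the expectation is fixed by those for \<open>c = 0\<close> and
    \<open>c = 1\<close>.\<close>
  have "I c \<sigma> = (1 - c) * I 0 \<sigma> + c * I 1 \<sigma>" if "0 \<le> c" "\<sigma> \<in> ?P" for c \<sigma>
  proof -
    have "I c \<sigma> = (\<integral>\<omega>. (1 - c) * value_of (f 0) (outcome A (f 0) \<sigma> \<omega>)
        + c * value_of (f 1) (outcome A (f 1) \<sigma> \<omega>) \<partial>coins A)"
      unfolding I_def
    proof (rule Bochner_Integration.integral_cong[OF refl])
      fix \<omega> assume \<omega>: "\<omega> \<in> space (coins A)"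
      show "value_of (f c) (outcome A (f c) \<sigma> \<omega>) = (1 - c) * value_of (f 0) (outcome A (f 0) \<sigma> \<omega>)
        + c * value_of (f 1) (outcome A (f 1) \<sigma> \<omega>)"
        unfolding out[OF that(2) \<omega>, of c] out[OF that(2) \<omega>, of 1]
        by (auto simp: value_of_def f_def split: option.splits)
    qed
    also have "\<dots> = (1 - c) * I 0 \<sigma> + c * I 1 \<sigma>"
      unfolding I_def using int[OF _ that(2)] by simp
    finally show ?thesis .
  qed
  then have "(\<Sum>\<sigma>\<in>?P. I c \<sigma>) = (\<Sum>\<sigma>\<in>?P. (1 - c) * I 0 \<sigma> + c * I 1 \<sigma>)" if "0 \<le> c" for c
    using that by (intro sum.cong refl)
  then have sum_I: "(\<Sum>\<sigma>\<in>?P. I c \<sigma>) = (1 - c) * (\<Sum>\<sigma>\<in>?P. I 0 \<sigma>) + c * (\<Sum>\<sigma>\<in>?P. I 1 \<sigma>)" if "0 \<le> c" for c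
    using that unfolding sum_distrib_left sum.distrib .
  have lin: "expected_value E A (f c) = (1 - c) * expected_value E A (f 0) + c * expected_value E A (f 1)"
    if "0 \<le> c" for c
    unfolding EV sum_I[OF that] by (simp add: add_divide_distrib)
  have le1: "expected_value E A (f c) \<le> 1" if "c \<in> {0, 1}" for c
  proof -
    have "I c \<sigma> \<le> 1" if "\<sigma> \<in> ?P" for \<sigma>
      unfolding I_def using int[OF _ that, of c] \<open>c \<in> {0, 1}\<close>
      by (intro integral_le_const) (auto simp: value_of_def f_def split: option.splits)
    then have "(\<Sum>\<sigma>\<in>?P. I c \<sigma>) \<le> (\<Sum>\<sigma>\<in>?P. 1)" by (intro sum_mono)
    then show ?thesis unfolding EV using E(1) by simp
  qed
  \<comment> \<open>For \<open>c = 0\<close> the empty set has value 1, so an output that avoids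
    \<open>e\<close> must have probability at least \<open>1 / 2 + \<epsilon>\<close>.\<close>
  have "f 0 {} \<le> opt_value E k (f 0)" using E(1) by (intro opt_value_ge) auto
  then have "1 / 2 + \<epsilon> \<le> (1 / 2 + \<epsilon>) * opt_value E k (f 0)"
    using \<epsilon> by (simp add: f_def)
  then have e0: "1 / 2 + \<epsilon> \<le> expected_value E A (f 0)"
    using approx sub[of 0] unfolding achieves_approximation_def by force
  \<comment> \<open>The output contains \<open>e\<close> with probability at most
    \<open>1 / 2 - \<epsilon>\<close>, so the expected value is at most
    \<open>1 + c * (1 / 2 - \<epsilon>)\<close>; this is less than
    \<open>(1 / 2 + \<epsilon>) * c\<close> as soon as
    \<open>2 * \<epsilon> * c > 1\<close>.\<close>
  define c where "c = 1 / \<epsilon>"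
  have c: "0 \<le> c" "0 < c" "\<epsilon> * c = 1" unfolding c_def using \<epsilon> by auto
  have "f c {e} \<le> opt_value E k (f c)" using E(1) e k by (intro opt_value_ge) auto
  then have "(1 / 2 + \<epsilon>) * c \<le> (1 / 2 + \<epsilon>) * opt_value E k (f c)"
    using \<epsilon> by (simp add: f_def)
  also have "\<dots> \<le> expected_value E A (f c)"
    using approx sub[OF c(1)] unfolding achieves_approximation_def by force
  also have "\<dots> = expected_value E A (f 0) + c * (expected_value E A (f 1) - expected_value E A (f 0))"
    unfolding lin[OF c(1)] by (simp add: algebra_simps)
  also have "\<dots> \<le> 1 + c * (1 - (1 / 2 + \<epsilon>))"
    using le1[of 0] le1[of 1] e0 c by (intro add_mono mult_left_mono) auto
  finally have "2 * (\<epsilon> * c) \<le> 1" by (simp add: algebra_simps)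
  then show False using c by simp
qed

section \<open>Averaging over the planted block\<close>

context block_instance
begin

text \<open>The guarantee is summed over all \<open>L\<close> choices of the planted block. For
  fixed order and coins, hidden blocks all lead to the output of the decoy run, whose at most
  \<open>k\<close> elements earn at most \<open>b / q\<close> each, in one block only: together
  \<open>b * k / q\<close>. Exposed blocks are charged the trivial value bound; the two summands of
  the last factor count those rich in some snapshot and, on average over the orders, the dense
  ones.\<close>

lemma planted_block_average:
  fixes A :: "('a, 'i, 'r) stream_algorithm" and \<alpha> H :: real
  assumes strong: "strong_algorithm E k A" and approx: "achieves_approximation \<alpha> E k A"
    and buf: "buffer_at_most element_cost E A m" and \<alpha>: "0 \<le> \<alpha>"
    and H: "\<And>Y. Y \<subseteq> E \<Longrightarrow> card Y \<le> k \<Longrightarrow> F (\<lambda>_. 2 * r) Y \<le> H"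
    and room: "q + a * b \<le> k" and w: "0 < w" and r: "0 < r" and E: "2 \<le> card E"
  shows "\<alpha> * (b * (2 - 1 / a)) * L \<le> L * H + real b * k / q + (H + real b * k / q) *
    (real (Suc (Suc (card E) div w) * m) / Suc r + L * q * q * w / (r * Suc r * (card E - 1)))"
proof -
  let ?P = "permutations_of_set E"
  let ?W = "dense_blocks w r B L"
  \<comment> \<open>The decoy cap \<open>2 * r\<close> equals the visibility threshold of
    \<open>card_rich_blocks\<close>, so \<open>F_raise_cap_eq\<close> applies to every query as long
    as a block stays below it.\<close>
  define g where "g J = F ((\<lambda>_. 2 * r)(J := q))" for J
  define g0 where "g0 = F (\<lambda>_. 2 * r)"
  define d where "d = real b * k / q"
  define G where "G = real (Suc (Suc (card E) div w) * m) / Suc r"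
  define val where "val J \<sigma> \<omega> = value_of (g J) (outcome A (g J) \<sigma> \<omega>)" for J \<sigma> \<omega>
  have alg: "stream_algorithm_on E A" using strong unfolding strong_algorithm_def by auto
  interpret prob_space "coins A" using alg unfolding stream_algorithm_on_def by auto
  have sub: "nonneg_submodular E (g J)" "nonneg_submodular E g0" for J
    unfolding g_def g0_def by (rule F_nonneg_submodular)+
  have d0: "0 \<le> d" unfolding d_def by simp
  have "0 \<le> F (\<lambda>_. 2 * r) {}" by (rule F_nonneg)
  also have "\<dots> \<le> H" by (rule H) auto
  finally have H0: "0 \<le> H" .
  have bB: "card (Y \<inter> B J) \<le> k" if "Y \<subseteq> E" "card Y \<le> k" for Y J
    using that card_mono[of Y "Y \<inter> B J"] finite_subset[OF _ finite_E, of Y] by auto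
  have gJ: "g J Y \<le> H + real b * card (Y \<inter> B J) / real q" if "J < L" "Y \<subseteq> E" "card Y \<le> k" for J Y
    using F_raise_cap_le[OF that(1), of "\<lambda>_. 2 * r" Y] H[OF that(2,3)] unfolding g_def by linarith
  have pointwise: "(\<Sum>J<L. val J \<sigma> \<omega>) \<le> L * H + d + (H + d) * (G + card (?W \<sigma>))"
    if \<sigma>: "\<sigma> \<in> ?P" and \<omega>: "\<omega> \<in> space (coins A)" for \<sigma> \<omega>
  proof -
    have set\<sigma>: "set \<sigma> = E" using permutations_of_setD(1)[OF \<sigma>] .
    have len: "length \<sigma> = card E" using length_finite_permutations_of_set[OF \<sigma>] .
    interpret stream_run E A g0 \<sigma> \<omega> using alg set\<sigma> by unfold_locales
    define D where "D = {J. J < L \<and> (\<exists>T es s. R T = Running es s \<and> 2 * r < card (fst s \<inter> B J))}"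
    have "card (D - ?W \<sigma>) * Suc r \<le> Suc (Suc (length \<sigma>) div w) * m"
    proof (rule card_rich_blocks[OF _ disjoint_B finite_E w D_def dense_blocks_def])
      fix T es s assume "R T = Running es s"
      then show "card (fst s) \<le> m"
        using buf \<sigma> \<omega> sub(2) unfolding buffer_at_most_def element_cost_def by blast
    qed
    then have "real (card (D - ?W \<sigma>) * Suc r) \<le> real (Suc (Suc (card E) div w) * m)"
      unfolding len by (rule of_nat_mono)
    then have "real (card (D - ?W \<sigma>)) * real (Suc r) \<le> real (Suc (Suc (card E) div w) * m)"
      by (simp only: of_nat_mult)
    then have "real (card (D - ?W \<sigma>)) \<le> G"
      unfolding G_def by (simp only: pos_le_divide_eq of_nat_0_less_iff zero_less_Suc)
    moreover have "card D \<le> card (D - ?W \<sigma>) + card (?W \<sigma>)"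
    proof -
      have "card D \<le> card ((D - ?W \<sigma>) \<union> ?W \<sigma>)"
        by (intro card_mono) (auto simp: D_def dense_blocks_def)
      also have "\<dots> \<le> card (D - ?W \<sigma>) + card (?W \<sigma>)" by (rule card_Un_le)
      finally show ?thesis .
    qed
    ultimately have cardD: "real (card D) \<le> G + card (?W \<sigma>)" by linarith
    define c where "c J = (case outcome A g0 \<sigma> \<omega> of None \<Rightarrow> 0 | Some Y \<Rightarrow> card (Y \<inter> B J))" for J
    have c: "(\<Sum>J<L. c J) \<le> k"
    proof (cases "outcome A g0 \<sigma> \<omega>")
      case (Some Y)
      then have Y: "Y \<subseteq> E" "card Y \<le> k" using outcome_bounds[OF strong set\<sigma>] by auto
      have finY: "finite Y" using Y(1) finite_E by (rule finite_subset)
      have "(\<Sum>J<L. c J) = (\<Sum>J<L. card (Y \<inter> B J))" unfolding c_def Some by simp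
      also have "\<dots> = card (\<Union>J<L. Y \<inter> B J)"
        using disjoint_B finY unfolding disjoint_family_on_def
        by (intro card_UN_disjoint[symmetric]) auto
      also have "\<dots> \<le> card Y" using finY by (intro card_mono) auto
      finally show ?thesis using Y by simp
    qed (simp add: c_def)
    \<comment> \<open>Exposed blocks pay \<open>H + d\<close> on top of the bound for hidden ones,
      which gives a single formula to sum over \<open>J\<close>.\<close>
    have "val J \<sigma> \<omega> \<le> H + real b * c J / q + (if J \<in> D then H + d else 0)" if J: "J < L" for J
    proof (cases "J \<in> D")
      case True
      have "val J \<sigma> \<omega> \<le> H + d"
      proof (cases "outcome A (g J) \<sigma> \<omega>")
        case None
        then show ?thesis unfolding val_def value_of_def using H0 d0 by simp
      next
        case (Some Y)
        then have Y: "Y \<subseteq> E" "card Y \<le> k" using outcome_bounds[OF strong set\<sigma>] by auto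
        have "real b * card (Y \<inter> B J) / q \<le> d"
          unfolding d_def using bB[OF Y] by (intro divide_right_mono mult_left_mono) auto
        then show ?thesis using gJ[OF J Y] unfolding val_def value_of_def Some by simp
      qed
      moreover have "0 \<le> real b * c J / q" by simp
      ultimately show ?thesis unfolding if_P[OF True] using H0 by linarith
    next
      case False
      have "outcome A (g J) \<sigma> \<omega> = outcome A g0 \<sigma> \<omega>"
      proof (rule outcome_cong, rule run_eq_if_queries_eq[OF alg set\<sigma>])
        fix T es s S assume R: "R T = Running es s" and S: "S \<subseteq> fst s"
        have "fst s \<subseteq> E" using run_Running_drop[OF R] by auto
        then have "finite (fst s)" using finite_E by (rule finite_subset)
        then have "card (S \<inter> B J) \<le> card (fst s \<inter> B J)" using S by (intro card_mono) auto
        also have "\<dots> \<le> 2 * r"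
        proof (rule ccontr)
          assume "\<not> card (fst s \<inter> B J) \<le> 2 * r"
          then have "J \<in> D" unfolding D_def mem_Collect_eq not_le using J R by blast
          then show False using False by simp
        qed
        finally show "g J S = g0 S" unfolding g_def g0_def using J by (intro F_raise_cap_eq) auto
      qed
      then show ?thesis
        using False H0 gJ[OF J] outcome_bounds[OF strong set\<sigma>]
        by (auto simp: val_def c_def value_of_def split: option.splits)
    qed
    then have "(\<Sum>J<L. val J \<sigma> \<omega>) \<le> (\<Sum>J<L. H + real b * c J / q + (if J \<in> D then H + d else 0))"
      by (intro sum_mono) auto
    also have "\<dots> = L * H + b * real (\<Sum>J<L. c J) / q + (\<Sum>J<L. if J \<in> D then H + d else 0)"
      by (simp add: sum.distrib sum_distrib_left sum_divide_distrib)
    also have "(\<Sum>J<L. if J \<in> D then H + d else 0) = (H + d) * card D"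
    proof -
      have "{..<L} \<inter> D = D" unfolding D_def by auto
      then show ?thesis by (simp add: sum.If_cases)
    qed
    also have "L * H + b * real (\<Sum>J<L. c J) / q + (H + d) * card D \<le> L * H + d + (H + d) * (G + card (?W \<sigma>))"
    proof (intro add_mono order_refl mult_left_mono cardD)
      show "b * real (\<Sum>J<L. c J) / q \<le> d"
        unfolding d_def using c by (intro divide_right_mono mult_left_mono of_nat_mono) auto
    qed (use H0 d0 in auto)
    finally show ?thesis .
  qed
  have integral: "(\<Sum>J<L. \<integral>\<omega>. val J \<sigma> \<omega> \<partial>coins A) \<le> L * H + d + (H + d) * (G + card (?W \<sigma>))"
    if \<sigma>: "\<sigma> \<in> ?P" for \<sigma>
  proof -
    have int: "integrable (coins A) (val J \<sigma>)" for J
      unfolding val_def by (rule integrable_value_of_outcome[OF strong finite_E \<sigma> sub(1)])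
    have "(\<Sum>J<L. \<integral>\<omega>. val J \<sigma> \<omega> \<partial>coins A) = (\<integral>\<omega>. (\<Sum>J<L. val J \<sigma> \<omega>) \<partial>coins A)"
      using int by (intro Bochner_Integration.integral_sum[symmetric]) auto
    also have "\<dots> \<le> L * H + d + (H + d) * (G + card (?W \<sigma>))"
      using int pointwise[OF \<sigma>] by (intro integral_le_const) auto
    finally show ?thesis .
  qed
  have "\<alpha> * (b * (2 - 1 / a)) \<le> (\<Sum>\<sigma>\<in>?P. \<integral>\<omega>. val J \<sigma> \<omega> \<partial>coins A) / fact (card E)" if J: "J < L" for J
  proof -
    let ?O = "B J \<union> (V - C J)"
    have "card ?O \<le> card (B J) + card (V - C J)" by (rule card_Un_le)
    also have "\<dots> \<le> q + a * b"
      using card_B[OF J] card_mono[OF finite_V, of "V - C J"] card_V by auto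
    finally have "card ?O \<le> k" using room by simp
    moreover have "?O \<subseteq> E" using B_subset[OF J] V_subset by auto
    ultimately have "g J ?O \<le> opt_value E k (g J)" using finite_E by (intro opt_value_ge)
    moreover have "b * (2 - 1 / a) \<le> g J ?O" unfolding g_def using J by (intro F_planted) auto
    ultimately have "\<alpha> * (b * (2 - 1 / a)) \<le> \<alpha> * opt_value E k (g J)" using \<alpha> by (intro mult_left_mono) auto
    also have "\<dots> \<le> expected_value E A (g J)" using approx sub(1) unfolding achieves_approximation_def by blast
    finally show ?thesis unfolding expected_value_eq[OF finite_E] val_def .
  qed
  then have "(\<Sum>J<L. \<alpha> * (b * (2 - 1 / a))) \<le> (\<Sum>J<L. (\<Sum>\<sigma>\<in>?P. \<integral>\<omega>. val J \<sigma> \<omega> \<partial>coins A) / fact (card E))"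
    by (intro sum_mono) auto
  also have "\<dots> = (\<Sum>\<sigma>\<in>?P. \<Sum>J<L. \<integral>\<omega>. val J \<sigma> \<omega> \<partial>coins A) / fact (card E)"
    unfolding sum_divide_distrib[symmetric] by (subst sum.swap) simp
  also have "\<dots> \<le> (\<Sum>\<sigma>\<in>?P. L * H + d + (H + d) * (G + card (?W \<sigma>))) / fact (card E)"
    using integral by (intro divide_right_mono sum_mono) auto
  also have "(\<Sum>\<sigma>\<in>?P. L * H + d + (H + d) * (G + card (?W \<sigma>)))
      = fact (card E) * (L * H + d + (H + d) * G) + (H + d) * real (\<Sum>\<sigma>\<in>?P. card (?W \<sigma>))"
    using finite_E by (simp add: sum.distrib distrib_left sum_distrib_left)
  also have "\<dots> / fact (card E) = L * H + d + (H + d) * (G + real (\<Sum>\<sigma>\<in>?P. card (?W \<sigma>)) / fact (card E))"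
    by (simp add: add_divide_distrib distrib_left)
  also have "\<dots> \<le> L * H + d + (H + d) * (G + L * q * q * w / (r * Suc r * (card E - 1)))"
  proof (intro add_left_mono mult_left_mono)
    have "real ((\<Sum>\<sigma>\<in>?P. card (?W \<sigma>)) * (r * Suc r) * (card E - 1)) \<le> real (L * q * q * (fact (card E) * w))"
      using B_subset by (intro of_nat_mono sum_card_dense_blocks finite_E w card_B) auto
    then have "real (\<Sum>\<sigma>\<in>?P. card (?W \<sigma>)) * real (r * Suc r * (card E - 1)) \<le> real (L * q * q * w) * fact (card E)"
      unfolding of_nat_mult of_nat_fact by (simp only: mult_ac)
    moreover have "0 < r * Suc r * (card E - 1)" using r E by simp
    then have "0 < real (r * Suc r * (card E - 1))" by (simp only: of_nat_0_less_iff)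
    moreover have "x / y \<le> z / v" if "x * v \<le> z * y" "0 < v" "0 < y" for x y z v :: real
      using that by (simp add: field_simps)
    ultimately show "real (\<Sum>\<sigma>\<in>?P. card (?W \<sigma>)) / fact (card E)
        \<le> real (L * q * q * w) / real (r * Suc r * (card E - 1))"
      using fact_gt_zero by blast
  qed (use H0 d0 in simp)
  finally show ?thesis unfolding d_def G_def by (simp add: mult.commute)
qed

end

section \<open>The lower bound\<close>

text \<open>If \<open>m \<le> card E / k^2\<close>, dividing \<open>planted_block_average\<close> by
  \<open>b * L\<close> leaves at least \<open>1 + 3 / 2 * \<epsilon>\<close> on the left and at most
  \<open>1 + 13 / 16 * \<delta>\<close> on the right. The constants \<open>c\<close> and
  \<open>k0\<close> depend only on \<open>\<epsilon>\<close>, as the passage to sequences of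
  instances requires; the case \<open>card E < k^2\<close> is left to
  \<open>buffer_positive\<close>.\<close>

lemma strong_buffer_bound:
  fixes \<epsilon> :: real
  assumes \<epsilon>: "0 < \<epsilon>"
  shows "\<exists>c>0. \<exists>k0. \<forall>k\<ge>k0. \<forall>(E :: 'a set) (A :: ('a, 'i, 'r) stream_algorithm) m.
    finite E \<longrightarrow> k ^ 2 \<le> card E \<longrightarrow> ln (card E) \<le> c * real k \<longrightarrow>
    strong_algorithm E k A \<longrightarrow> achieves_approximation (1 / 2 + \<epsilon>) E k A \<longrightarrow>
    buffer_at_most element_cost E A m \<longrightarrow> card E / real k ^ 2 < m"
proof -
  define \<delta> where "\<delta> = min \<epsilon> 1"
  have \<delta>: "0 < \<delta>" "\<delta> \<le> 1" "\<delta> \<le> \<epsilon>" unfolding \<delta>_def using \<epsilon> by auto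
  define \<nu> where "\<nu> = \<delta> / 4"
  have \<nu>: "0 < \<nu>" unfolding \<nu>_def using \<delta> by simp
  \<comment> \<open>Large \<open>a\<close> makes the loss \<open>(1 / 2 + \<epsilon>) / a\<close> at
    most \<open>\<epsilon> / 2\<close>.\<close>
  obtain a :: nat where a: "(1 + 2 * \<epsilon>) / \<epsilon> + 2 \<le> a" using real_arch_simple by blast
  \<comment> \<open>\<open>V\<close> will have at most \<open>k / d\<close> elements;
    \<open>d / (d - 1) \<le> 1 + \<delta> / 4\<close> then bounds \<open>k / q\<close>.\<close>
  obtain d :: nat where d: "4 / \<delta> + 1 \<le> d" using real_arch_simple by blast
  \<comment> \<open>\<open>u\<close> and \<open>\<eta>\<close> each claim half of the allowance
    \<open>(\<nu> * k)^2\<close> in \<open>F_small\<close>: \<open>u\<close> makes the cap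
    \<open>2 * r\<close> small, \<open>\<eta>\<close> the overlaps.\<close>
  obtain u :: nat where u: "4 * a / \<nu>\<^sup>2 + 1 \<le> u" using real_arch_simple by blast
  define \<eta> where "\<eta> = min (1 / 4) (\<nu>\<^sup>2 / (2 * a))"
  have "0 < (1 + 2 * \<epsilon>) / \<epsilon>" using \<epsilon> by simp
  then have a2: "2 \<le> a" using a by linarith
  have a_ge: "1 + 2 * \<epsilon> \<le> a * \<epsilon>"
  proof -
    have "(1 + 2 * \<epsilon>) / \<epsilon> \<le> a" using a by simp
    then show ?thesis using \<epsilon> by (simp add: pos_divide_le_eq)
  qed
  have "0 \<le> 4 / \<delta>" using \<delta> by simp
  then have d1: "1 \<le> d" using d by linarith
  have d_ge: "4 \<le> \<delta> * (real d - 1)"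
  proof -
    have "4 / \<delta> \<le> real d - 1" using d by simp
    then show ?thesis using \<delta> by (simp add: pos_divide_le_eq mult.commute)
  qed
  have "0 \<le> 4 * a / \<nu>\<^sup>2" by simp
  then have u1: "1 \<le> u" using u by linarith
  have u_ge: "4 * a \<le> \<nu>\<^sup>2 * u"
  proof -
    have "4 * a / \<nu>\<^sup>2 \<le> u" using u by simp
    then show ?thesis using \<nu> by (simp add: pos_divide_le_eq mult.commute)
  qed
  have \<eta>: "0 < \<eta>" "\<eta> \<le> 1 / 4" unfolding \<eta>_def using \<nu> a2 by auto
  have \<eta>\<nu>: "a * \<eta> \<le> \<nu>\<^sup>2 / 2"
  proof -
    have "a * \<eta> \<le> a * (\<nu>\<^sup>2 / (2 * a))" unfolding \<eta>_def by (intro mult_left_mono) auto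
    also have "\<dots> = \<nu>\<^sup>2 / 2" using a2 by simp
    finally show ?thesis .
  qed
  \<comment> \<open>\<open>b\<close> is at least \<open>k / (2 * a * d)\<close>, so this
    \<open>c\<close> gives \<open>ln n \<le> \<eta>^2 * b / 4\<close>, room for one label per
    block.\<close>
  define c where "c = \<eta>\<^sup>2 / (8 * a * d)"
  have c0: "0 < c" unfolding c_def using \<eta> a2 d1 by simp
  \<comment> \<open>The summands serve in turn the roundings in \<open>b\<close> and
    \<open>r\<close>, the bound \<open>n \<ge> 4 * k\<close>, and the error terms
    \<open>\<kappa>' / L\<close>, \<open>X1 / L\<close> and \<open>X2\<close>.\<close>
  obtain k0 :: nat where k0: "2 * a * d + 2 * u + 4 + 32 / \<delta> + (1920 * u + 768 * u\<^sup>2) / \<delta> \<le> k0"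
    using real_arch_simple by blast
  have "card E / real k ^ 2 < m"
    if k: "k0 \<le> k" and E: "finite E" and nk: "k ^ 2 \<le> card E" and ln: "ln (card E) \<le> c * real k"
      and strong: "strong_algorithm E k A" and approx: "achieves_approximation (1 / 2 + \<epsilon>) E k A"
      and buf: "buffer_at_most element_cost E A m"
    for k m and E :: "'a set" and A :: "('a, 'i, 'r) stream_algorithm"
  proof (rule ccontr)
    assume "\<not> card E / real k ^ 2 < m"
    then have m: "m \<le> card E / real k ^ 2" by simp
    define n where "n = card E"
    have large: "0 \<le> 2 * real a * d" "0 \<le> 2 * real u" "0 \<le> 32 / \<delta>" "0 \<le> 1920 * u / \<delta>" "0 \<le> 768 * (real u)\<^sup>2 / \<delta>"
      using \<delta> by auto
    have split: "2 * real a * d + 2 * real u + 4 + 32 / \<delta> + 1920 * u / \<delta> + 768 * (real u)\<^sup>2 / \<delta> \<le> k"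
      using k0 k by (simp add: add_divide_distrib)
    have k_ad: "2 * real a * d \<le> k" and k_u: "2 * real u \<le> k" and k4: "4 \<le> real k"
      and k_32: "32 / \<delta> \<le> k" and k_1920: "1920 * u / \<delta> \<le> k" and k_768: "768 * (real u)\<^sup>2 / \<delta> \<le> k"
      using split large by linarith+
    have kpos: "0 < k" using k4 by simp
    have n_ge: "real k ^ 2 \<le> n" using nk unfolding n_def by (metis of_nat_le_iff of_nat_power)
    have n4k: "4 * real k \<le> n"
    proof -
      have "4 * real k \<le> k * real k" using k4 by (intro mult_right_mono) auto
      then show ?thesis using n_ge by (simp add: power2_eq_square)
    qed
    have npos: "0 < n" using n4k k4 by linarith
    define b where "b = k div (a * d)"
    define q where "q = k - a * b"
    define r where "r = k div u"
    \<comment> \<open>Windows of length about \<open>n / k\<close> contain about one element of a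
      block on average, far below \<open>r\<close>, and there are only about \<open>k\<close> of
      them.\<close>
    define w where "w = n div k"
    define L where "L = (n - a * b) div q"
    \<comment> \<open>Rounding down a quotient of at least 2 loses at most half of it.\<close>
    have div_ge: "real x / (2 * real y) \<le> real (x div y)" if "0 < y" "2 * real y \<le> x" for x y :: nat
    proof -
      have "real x / y - 1 \<le> real (x div y)"
        using floor_divide_of_nat_eq[of x y, where ?'a = real] by linarith
      moreover have "1 \<le> real x / (2 * y)" using that by simp
      moreover have "real x / y = 2 * (real x / (2 * y))" by simp
      ultimately show ?thesis by linarith
    qed
    have b_ge: "real k / (2 * (a * d)) \<le> b"
      unfolding b_def using div_ge[of "a * d" k] k_ad a2 d1 by simp
    have bpos: "0 < b"
    proof -
      have "0 < real k / (2 * (a * d))" using kpos a2 d1 by simp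
      then show ?thesis using b_ge by linarith
    qed
    have "b * (a * d) \<le> k" unfolding b_def by simp
    then have abd: "a * b * d \<le> k" by (simp add: mult_ac)
    have ab_less: "a * b < k"
    proof -
      have "2 \<le> d" using d_ge \<delta> by (cases "d = 1") (use d1 in auto)
      then have "a * b * 2 \<le> a * b * d" by (intro mult_left_mono) auto
      then show ?thesis using abd kpos by linarith
    qed
    have q_real: "real q = real k - real (a * b)" and qpos: "0 < q" and qk: "q \<le> k"
      unfolding q_def using ab_less by auto
    have \<kappa>: "real k / q \<le> 1 + \<delta> / 4"
    proof -
      have "real (a * b * d) \<le> real k" using abd by (rule of_nat_mono)
      then have "(real d - 1) * k \<le> d * real q" unfolding q_real by (simp add: algebra_simps)
      then have "(1 + \<delta> / 4) * ((real d - 1) * k) \<le> (1 + \<delta> / 4) * (d * real q)"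
        using \<delta> by (intro mult_left_mono) auto
      moreover have "real d * k \<le> (1 + \<delta> / 4) * (real d - 1) * k"
      proof (intro mult_right_mono)
        show "real d \<le> (1 + \<delta> / 4) * (real d - 1)" using d_ge by (simp add: distrib_right)
      qed simp
      ultimately have "real d * k \<le> d * ((1 + \<delta> / 4) * real q)" by (simp only: mult_ac)
      then have "real k \<le> (1 + \<delta> / 4) * real q" using d1 by simp
      then show ?thesis using qpos by (simp add: pos_divide_le_eq)
    qed
    have r_ge: "real k / (2 * u) \<le> r" unfolding r_def using div_ge[of u k] k_u u1 by simp
    have rpos: "0 < r"
    proof -
      have "0 < real k / (2 * u)" using kpos u1 by simp
      then show ?thesis using r_ge by linarith
    qed
    have ru: "real r * u \<le> k" unfolding r_def by (metis div_times_less_eq_dividend of_nat_le_iff of_nat_mult)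
    have w_ge: "real n / (2 * k) \<le> w" unfolding w_def using div_ge[of k n] kpos n4k by simp
    have wpos: "0 < w"
    proof -
      have "0 < real n / (2 * k)" using kpos npos by simp
      then show ?thesis using w_ge by linarith
    qed
    have wk: "real w * k \<le> n" unfolding w_def by (metis div_times_less_eq_dividend of_nat_le_iff of_nat_mult)
    have L_ge: "real n / (2 * k) \<le> L"
    proof -
      \<comment> \<open>Removing \<open>V\<close> costs at most one block of size \<open>k\<close>;
        \<open>n \<ge> 4 * k\<close> absorbs this along with the rounding.\<close>
      have "real n / (2 * k) \<le> real (n div k) - 1"
      proof -
        have "real n / k - 1 \<le> real (n div k)"
          using floor_divide_of_nat_eq[of n k, where ?'a = real] by linarith
        moreover have "2 \<le> real n / (2 * k)" using n4k kpos by (simp add: pos_le_divide_eq)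
        moreover have "real n / k = 2 * (real n / (2 * k))" by simp
        ultimately show ?thesis by linarith
      qed
      also have "\<dots> \<le> real ((n - k) div k)"
        using n4k kpos le_div_geq[of k n] by (cases "k \<le> n") auto
      also have "\<dots> \<le> L"
        unfolding L_def using ab_less qpos qk
        by (intro of_nat_mono order_trans[OF div_le_mono div_le_mono2]) auto
      finally show ?thesis .
    qed
    have Lk: "real k / 2 \<le> L"
    proof -
      have "real k / 2 = real k ^ 2 / (2 * k)" using kpos by (simp add: power2_eq_square)
      also have "\<dots> \<le> n / (2 * k)" using n_ge by (intro divide_right_mono) auto
      finally show ?thesis using L_ge by linarith
    qed
    have Lpos: "0 < L" using Lk k4 by linarith
    have L_le: "real L \<le> exp (\<eta>\<^sup>2 * b / 4)"
    proof -
      have "L \<le> n" unfolding L_def by (meson diff_le_self div_le_dividend le_trans)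
      then have "real L \<le> exp (ln n)" using npos by simp
      also have "ln n \<le> \<eta>\<^sup>2 * b / 4"
      proof -
        have "ln n \<le> c * k" using ln unfolding n_def .
        also have "\<dots> = \<eta>\<^sup>2 / 4 * (real k / (2 * (a * d)))" unfolding c_def by simp
        also have "\<dots> \<le> \<eta>\<^sup>2 / 4 * b" using b_ge by (intro mult_left_mono) auto
        finally show ?thesis by simp
      qed
      finally show ?thesis by simp
    qed
    have fits: "a * b + L * q \<le> card E"
    proof -
      have "L * q \<le> n - a * b" unfolding L_def by simp
      moreover have "a * b \<le> n" using ab_less n4k by linarith
      ultimately show ?thesis unfolding n_def by linarith
    qed
    obtain V B where V: "V \<subseteq> E" "card V = a * b" and B: "\<And>j. j < L \<Longrightarrow> B j \<subseteq> E - V"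
      "\<And>j. j < L \<Longrightarrow> card (B j) = q" "disjoint_family_on B {..<L}"
      using obtain_blocks[OF E fits] by blast
    have finV: "finite V" using V(1) E by (rule finite_subset)
    obtain C where C: "\<And>j. j < L \<Longrightarrow> C j \<subseteq> V" "\<And>j. j < L \<Longrightarrow> card (C j) = b"
      "\<And>i j. i < L \<Longrightarrow> j < L \<Longrightarrow> i \<noteq> j \<Longrightarrow> card (C i \<inter> C j) \<le> b / a + \<eta> * b"
      using nearly_independent_sets[OF finV V(2) a2 \<eta> L_le] by blast
    interpret block_instance E V B C L q a b
      using E V B C a2 qpos by unfold_locales auto
    define \<kappa>' where "\<kappa>' = real k / q"
    define H where "H = \<kappa>' * b * (1 + \<nu>)"
    have \<kappa>'0: "0 \<le> \<kappa>'" unfolding \<kappa>'_def by simp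
    have bound: "F (\<lambda>_. 2 * r) Y \<le> H" if "Y \<subseteq> E" "card Y \<le> k" for Y
      unfolding H_def \<kappa>'_def
    proof (rule F_small[OF C(3) qk _ _ _ that])
      have "u * (a * (2 * r * k)) \<le> 2 * a * (real k)\<^sup>2"
      proof -
        have "2 * a * k * (real r * u) \<le> 2 * a * k * real k" using ru by (intro mult_left_mono) auto
        then show ?thesis by (simp add: power2_eq_square mult_ac)
      qed
      also have "\<dots> \<le> u * (\<nu>\<^sup>2 / 2 * (real k)\<^sup>2)"
      proof -
        have "4 * a * (real k)\<^sup>2 \<le> \<nu>\<^sup>2 * u * (real k)\<^sup>2" using u_ge by (intro mult_right_mono) auto
        then show ?thesis by (simp add: mult_ac)
      qed
      finally have "a * (2 * r * k) \<le> \<nu>\<^sup>2 / 2 * (real k)\<^sup>2" using u1 by simp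
      moreover have "a * \<eta> * (real k)\<^sup>2 \<le> \<nu>\<^sup>2 / 2 * (real k)\<^sup>2" using \<eta>\<nu> by (intro mult_right_mono) auto
      ultimately show "real a * (real (2 * r) * real k + \<eta> * (real k)\<^sup>2) \<le> (\<nu> * real k)\<^sup>2"
        by (simp add: power_mult_distrib algebra_simps)
    qed (use \<nu> \<eta> in auto)
    have room: "q + a * b \<le> k" unfolding q_def using ab_less by simp
    have n2: "2 \<le> card E" using n4k k4 unfolding n_def by linarith
    \<comment> \<open>Exposed blocks of the two kinds: \<open>X1\<close> bounds the number of those
      rich at a snapshot, \<open>X2\<close> the average fraction of dense ones.\<close>
    define X1 where "X1 = real (Suc (Suc n div w) * m) / Suc r"
    define X2 where "X2 = real q * q * w / (r * Suc r * (n - 1))"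
    have "(1 / 2 + \<epsilon>) * (b * (2 - 1 / a)) * L \<le> L * H + real b * k / q + (H + real b * k / q) *
      (real (Suc (Suc n div w) * m) / Suc r + L * q * q * w / (r * Suc r * (n - 1)))"
      unfolding n_def using planted_block_average[OF strong approx buf _ bound room wpos rpos n2] \<epsilon> by simp
    also have "\<dots> = L * b * (\<kappa>' * (1 + \<nu>)) + b * \<kappa>' + b * (\<kappa>' * (2 + \<nu>)) * (X1 + L * X2)"
    proof -
      have e1: "real b * k / q = b * \<kappa>'" unfolding \<kappa>'_def by simp
      have e2: "L * q * q * w / (r * Suc r * (n - 1)) = L * X2"
        unfolding X2_def by (simp only: of_nat_mult times_divide_eq_right mult.assoc)
      show ?thesis unfolding e1 e2 H_def X1_def[symmetric] by (simp only: algebra_simps) simp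
    qed
    also have "\<dots> = real b * real L * (\<kappa>' * (1 + \<nu>) + \<kappa>' / L + \<kappa>' * (2 + \<nu>) * (X1 / L + X2))"
      using Lpos by (simp add: field_simps)
    finally have "real b * real L * ((1 / 2 + \<epsilon>) * (2 - 1 / a))
        \<le> real b * real L * (\<kappa>' * (1 + \<nu>) + \<kappa>' / L + \<kappa>' * (2 + \<nu>) * (X1 / L + X2))"
      by (simp only: mult_ac of_nat_mult)
    then have main: "(1 / 2 + \<epsilon>) * (2 - 1 / a) \<le> \<kappa>' * (1 + \<nu>) + \<kappa>' / L + \<kappa>' * (2 + \<nu>) * (X1 / L + X2)"
      using bpos Lpos by simp
    have "(1 / 2 + \<epsilon>) / a \<le> \<epsilon> / 2"
      using a_ge a2 by (simp add: field_simps)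
    moreover have "(1 / 2 + \<epsilon>) * (2 - 1 / a) = 1 + 2 * \<epsilon> - (1 / 2 + \<epsilon>) / a"
      by (simp add: right_diff_distrib)
    ultimately have lhs: "1 + 3 / 2 * \<epsilon> \<le> (1 / 2 + \<epsilon>) * (2 - 1 / a)" by linarith
    have \<kappa>2: "\<kappa>' \<le> 1 + \<delta> / 4" "\<kappa>' \<le> 2" using \<kappa> \<delta> unfolding \<kappa>'_def by auto
    have t1: "\<kappa>' * (1 + \<nu>) \<le> 1 + 9 / 16 * \<delta>"
    proof -
      have "\<kappa>' * (1 + \<nu>) \<le> (1 + \<delta> / 4) * (1 + \<delta> / 4)"
        unfolding \<nu>_def using \<kappa>2(1) \<delta> by (intro mult_right_mono) auto
      also have "\<dots> = 1 + \<delta> / 2 + \<delta> * \<delta> / 16" by (simp add: algebra_simps)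
      also have "\<dots> \<le> 1 + 9 / 16 * \<delta>" using mult_left_le[of \<delta> \<delta>] \<delta> by simp
      finally show ?thesis .
    qed
    have t2: "\<kappa>' / L \<le> \<delta> / 8"
    proof -
      have "32 \<le> \<delta> * k" using k_32 \<delta> by (simp add: pos_divide_le_eq mult.commute)
      also have "\<dots> \<le> \<delta> * (2 * L)" using Lk \<delta> by (intro mult_left_mono) auto
      finally have "2 \<le> \<delta> / 8 * L" by simp
      then have "\<kappa>' \<le> \<delta> / 8 * L" using \<kappa>2 by linarith
      then show ?thesis using Lpos by (simp add: pos_divide_le_eq)
    qed
    \<comment> \<open>Here \<open>m \<le> n / k^2\<close> enters: about \<open>k\<close> snapshots
      of \<open>m\<close> elements hold \<open>O(n / k)\<close> elements, comparable to
      \<open>L\<close>, while each rich block takes up more than \<open>r\<close> of them, and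
      \<open>r\<close> is proportional to \<open>k\<close>.\<close>
    have t3: "X1 / L \<le> \<delta> / 96"
    proof -
      have "real (Suc n div w) \<le> 4 * real k"
      proof -
        have "real (Suc n div w) \<le> real (Suc n) / w" using floor_divide_of_nat_eq[of "Suc n" w, where ?'a = real] by linarith
        also have "\<dots> \<le> real (Suc n) / (real n / (2 * real k))"
          using w_ge npos kpos by (intro divide_left_mono) (auto simp: wpos)
        also have "\<dots> = 2 * real k * (real (Suc n) / n)" by simp
        also have "\<dots> \<le> 2 * real k * 2"
          using npos by (intro mult_left_mono) (auto simp: pos_divide_le_eq)
        finally show ?thesis by simp
      qed
      then have N: "real (Suc (Suc n div w)) \<le> 5 * real k" using k4 by simp
      have r': "real k \<le> 2 * real u * real (Suc r)" using r_ge u1 by (simp add: pos_divide_le_eq algebra_simps)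
      have L': "real n \<le> 2 * real k * real L" using L_ge kpos by (simp add: pos_divide_le_eq algebra_simps)
      have m': "real m * (real k)\<^sup>2 \<le> n" using m kpos unfolding n_def by (simp add: pos_le_divide_eq)
      have "(real (Suc (Suc n div w)) * real m) * real k ^ 2 \<le> 5 * real k * real n"
        using mult_mono[OF N m'] by (simp add: mult_ac)
      also have "\<dots> \<le> 5 * real k * (2 * real k * real L)" using L' by (intro mult_left_mono) auto
      finally have "(real (Suc (Suc n div w)) * real m) * real k ^ 2 \<le> (10 * real L) * real k ^ 2"
        by (simp add: power2_eq_square mult_ac)
      then have "real (Suc (Suc n div w)) * real m \<le> 10 * real L"
        by (rule mult_right_le_imp_le) (use kpos in simp)
      then have NM: "real (Suc (Suc n div w) * m) \<le> 10 * real L" by (simp only: of_nat_mult)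
      have "real u * 1920 \<le> \<delta> * k" using k_1920 \<delta> by (simp add: pos_divide_le_eq mult.commute)
      also have "\<dots> \<le> \<delta> * (2 * real u * real (Suc r))" using r' \<delta> by (intro mult_left_mono) auto
      finally have "960 * (2 * real u) \<le> \<delta> * real (Suc r) * (2 * real u)" by (simp add: mult_ac del: of_nat_Suc)
      then have "960 \<le> \<delta> * real (Suc r)" by (rule mult_right_le_imp_le) (use u1 in simp)
      then have "960 * real L \<le> \<delta> * real (Suc r) * real L" by (rule mult_right_mono) simp
      then have "real (Suc (Suc n div w) * m) \<le> \<delta> / 96 * (real (Suc r) * real L)"
        using NM by (simp add: mult.assoc del: of_nat_Suc of_nat_mult)
      then show ?thesis
        unfolding X1_def divide_divide_eq_left using Lpos
        by (subst pos_divide_le_eq) (simp_all del: of_nat_Suc of_nat_mult)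
    qed
    \<comment> \<open>About \<open>q^2\<close> pairs per block, each in a common window with
      probability about \<open>1 / k\<close>, against \<open>r^2\<close> pairs in a dense block: the
      ratio is \<open>O(1 / k)\<close>.\<close>
    have t4: "X2 \<le> \<delta> / 96"
    proof -
      have r': "real k \<le> 2 * real u * real r" using r_ge u1 by (simp add: pos_divide_le_eq algebra_simps)
      have n1: "real n \<le> 2 * real (n - 1)" using n2 unfolding n_def by simp
      have "real q * real q * real w \<le> real k * real k * real w" using qk by (intro mult_mono) auto
      also have "\<dots> = real k * (real w * real k)" by (simp add: mult_ac)
      also have "\<dots> \<le> real k * real n" using wk by (intro mult_left_mono) auto
      finally have num: "real q * real q * real w \<le> real k * real n" .
      have "768 * (real u)\<^sup>2 \<le> \<delta> * k" using k_768 \<delta> by (simp add: pos_divide_le_eq mult.commute)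
      then have "768 * (real u)\<^sup>2 * real k \<le> \<delta> * real k * real k" by (rule mult_right_mono) simp
      also have "\<dots> \<le> \<delta> * (2 * real u * real r) * (2 * real u * real r)"
        using r' \<delta> by (intro mult_mono) auto
      also have "\<dots> = (real u)\<^sup>2 * (4 * \<delta> * real r * real r)" by (simp add: power2_eq_square mult_ac)
      finally have "(real u)\<^sup>2 * (768 * real k) \<le> (real u)\<^sup>2 * (4 * \<delta> * real r * real r)" by (simp add: mult_ac)
      then have "192 * real k \<le> \<delta> * (real r * real r)" using u1 by (simp add: mult_ac)
      also have "\<dots> \<le> \<delta> * (real r * real (Suc r))" using \<delta> by (intro mult_left_mono) auto
      finally have kr: "192 * real k \<le> \<delta> * (real r * real (Suc r))" .
      have "192 * (real k * real n) \<le> \<delta> * (real r * real (Suc r)) * (2 * real (n - 1))"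
        using mult_mono[OF kr n1] \<delta> by (simp add: mult_ac)
      then have "real q * real q * real w \<le> \<delta> / 96 * (real r * real (Suc r) * real (n - 1))" using num by simp
      moreover have "0 < real r * real (Suc r) * real (n - 1)" using rpos n2 unfolding n_def by simp
      ultimately show ?thesis unfolding X2_def of_nat_mult by (simp only: pos_divide_le_eq)
    qed
    have "\<kappa>' * (2 + \<nu>) * (X1 / L + X2) \<le> 6 * (\<delta> / 48)"
    proof (intro mult_mono)
      have "\<kappa>' * (2 + \<nu>) \<le> 2 * 3" using \<kappa>2 \<kappa>'0 \<nu> \<delta> by (intro mult_mono) (auto simp: \<nu>_def)
      then show "\<kappa>' * (2 + \<nu>) \<le> 6" by simp
      show "X1 / L + X2 \<le> \<delta> / 48" using t3 t4 by linarith
      show "0 \<le> X1 / L + X2" unfolding X1_def X2_def by simp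
    qed simp
    then have "1 + 3 / 2 * \<epsilon> \<le> 1 + 9 / 16 * \<delta> + \<delta> / 8 + \<delta> / 8" using main lhs t1 t2 by linarith
    then show False using \<delta> by linarith
  qed
  then show ?thesis using c0 by blast
qed

text \<open>The constant in the asymptotic bound is 1. For \<open>k^2 \<le> n\<close>,
  \<open>strong_buffer_bound\<close> applies eventually, since \<open>g\<close> is
  \<open>o(k)\<close> and hence \<open>ln n \<le> c * k\<close>. Otherwise \<open>n / k^2\<close> is
  less than 1, and \<open>buffer_positive\<close> suffices.\<close>

lemma strong_buffer_asymptotic:
  fixes \<epsilon> :: real and n k buf :: "nat \<Rightarrow> nat" and g :: "nat \<Rightarrow> real" and E :: "nat \<Rightarrow> 'a set"
    and A :: "nat \<Rightarrow> ('a, 'i, 'r) stream_algorithm"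
  assumes \<epsilon>: "\<epsilon> > 0"
    and k: "filterlim k at_top sequentially"
    and g: "g \<in> o(\<lambda>j. real (k j))"
    and n: "\<And>j. real (n j) = 2 powr g j"
    and E: "\<And>j. finite (E j)" "\<And>j. card (E j) = n j"
    and A: "\<And>j. strong_algorithm (E j) (k j) (A j)"
      "\<And>j. achieves_approximation (1 / 2 + \<epsilon>) (E j) (k j) (A j)"
      "\<And>j. buffer_at_most element_cost (E j) (A j) (buf j)"
  shows "(\<lambda>j. real (buf j)) \<in> \<Omega>(\<lambda>j. real (n j) / real (k j) ^ 2)"
proof -
  obtain c k0 where c: "0 < c" and bound: "\<forall>k\<ge>k0. \<forall>(E :: 'a set) (A :: ('a, 'i, 'r) stream_algorithm) m.
    finite E \<longrightarrow> k ^ 2 \<le> card E \<longrightarrow> ln (card E) \<le> c * real k \<longrightarrow>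
    strong_algorithm E k A \<longrightarrow> achieves_approximation (1 / 2 + \<epsilon>) E k A \<longrightarrow>
    buffer_at_most element_cost E A m \<longrightarrow> card E / real k ^ 2 < m"
    using strong_buffer_bound[OF \<epsilon>] by (elim exE conjE)
  have "eventually (\<lambda>j. k0 + 1 \<le> k j) sequentially"
    using k unfolding filterlim_at_top by blast
  moreover have "eventually (\<lambda>j. norm (g j) \<le> c * norm (real (k j))) sequentially"
    using landau_o.smallD[OF g c] .
  ultimately have "eventually (\<lambda>j. 1 * norm (real (n j) / real (k j) ^ 2) \<le> norm (real (buf j))) sequentially"
  proof eventually_elim
    case (elim j)
    have "0 < real (n j)" unfolding n by simp
    then have npos: "0 < n j" by simp
    have "real (n j) / real (k j) ^ 2 \<le> buf j"
    proof (cases "k j ^ 2 \<le> n j")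
      case True
      have "ln (n j) = g j * ln 2" unfolding n by (simp add: ln_powr)
      also have "\<dots> \<le> \<bar>g j\<bar> * 1" using ln_2_less_1 by (intro mult_mono) auto
      also have "\<dots> \<le> c * k j" using elim(2) by simp
      finally have "ln (card (E j)) \<le> c * k j" unfolding E(2) .
      then have "card (E j) / real (k j) ^ 2 < buf j"
        using elim(1) True A by (intro bound[rule_format]) (auto simp: E)
      then show ?thesis unfolding E(2) by simp
    next
      case False
      have "E j \<noteq> {}" using E[of j] npos by auto
      then have "1 \<le> buf j"
        using elim(1) by (intro buffer_positive[OF A(1,2,3) \<epsilon> _ E(1)]) auto
      moreover have "real (n j) / real (k j) ^ 2 \<le> 1"
      proof -
        have "real (n j) \<le> real (k j ^ 2)" using False by simp
        then show ?thesis using elim(1) by (simp add: divide_le_eq)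
      qed
      ultimately show ?thesis by linarith
    qed
    then show ?case by simp
  qed
  then show ?thesis by (intro landau_omega.bigI[of 1]) auto
qed

theorem mainTheorem3:
  fixes \<epsilon> :: real
    and n k :: "nat \<Rightarrow> nat"
    and g :: "nat \<Rightarrow> real"
    and E :: "nat \<Rightarrow> 'a set"
  assumes "\<epsilon> > 0"
    and "filterlim k at_top sequentially"
    and "g \<in> o(\<lambda>j. real (k j))"
    and "\<And>j. real (n j) = 2 powr g j"
    and "\<And>j. finite (E j)"
    and "\<And>j. card (E j) = n j"
  shows
    "(\<forall>(A :: nat \<Rightarrow> ('a, bool list, 'r) stream_algorithm) buf.
        (\<forall>j. standard_algorithm (E j) (k j) (A j) \<and>
             achieves_approximation (1 / 2 + \<epsilon>) (E j) (k j) (A j) \<and>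
             buffer_at_most standard_cost (E j) (A j) (buf j)) \<longrightarrow>
        (\<lambda>j. real (buf j)) \<in> \<Omega>(\<lambda>j. real (n j) / real (k j) ^ 2)) \<and>
     (\<forall>(A :: nat \<Rightarrow> ('a, 'i, 'r) stream_algorithm) buf.
        (\<forall>j. strong_algorithm (E j) (k j) (A j) \<and>
             achieves_approximation (1 / 2 + \<epsilon>) (E j) (k j) (A j) \<and>
             buffer_at_most element_cost (E j) (A j) (buf j)) \<longrightarrow>
        (\<lambda>j. real (buf j)) \<in> \<Omega>(\<lambda>j. real (n j) / real (k j) ^ 2))"
proof (intro conjI allI impI)
  fix A :: "nat \<Rightarrow> ('a, bool list, 'r) stream_algorithm" and buf
  assume A: "\<forall>j. standard_algorithm (E j) (k j) (A j) \<and>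
    achieves_approximation (1 / 2 + \<epsilon>) (E j) (k j) (A j) \<and>
    buffer_at_most standard_cost (E j) (A j) (buf j)"
  \<comment> \<open>A standard algorithm is a strong one, as stored elements lie in the ground set,
    and its element cost is at most its standard cost.\<close>
  have "strong_algorithm (E j) (k j) (A j)" for j
    using A unfolding standard_algorithm_def strong_algorithm_def by (meson subset_trans)
  moreover have "buffer_at_most element_cost (E j) (A j) (buf j)" for j
    using A unfolding buffer_at_most_def standard_cost_def element_cost_def by (meson add_leD1)
  ultimately show "(\<lambda>j. real (buf j)) \<in> \<Omega>(\<lambda>j. real (n j) / real (k j) ^ 2)"
    using A by (intro strong_buffer_asymptotic[OF assms]) auto
next
  fix A :: "nat \<Rightarrow> ('a, 'i, 'r) stream_algorithm" and buf
  assume "\<forall>j. strong_algorithm (E j) (k j) (A j) \<and>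
    achieves_approximation (1 / 2 + \<epsilon>) (E j) (k j) (A j) \<and>
    buffer_at_most element_cost (E j) (A j) (buf j)"
  then show "(\<lambda>j. real (buf j)) \<in> \<Omega>(\<lambda>j. real (n j) / real (k j) ^ 2)"
    by (intro strong_buffer_asymptotic[OF assms]) auto
qed

end
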